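(* Let $\Gamma = (\Gamma, \le, \mu, (\varphi_x)_{x\in V(\Gamma)})$ be a trickle graph. (1) For every syllabic word $w \in S (\Gamma)^*$, $w$ is syllabically reduced if and only if $w$ is syllabically $M$-reduced. (2) For all $w, v \in S (\Gamma)^*$, if $w$ and $v$ are syllabically reduced and represent the same element of $\mathrm{Tr}(\Gamma)$, i.e. $\overline{w} = \overline{v}$, then $w$ can be transformed into $v$ by a finite (possibly empty) sequence of operations of type II.
   Context: **Trickle graphs.** For a simplicial graph $\Gamma$ (no loops or multiple edges, possibly infinite) with vertex set $V(\Gamma)$ and edge set $E(\Gamma)$, $\mathrm{star}_x(\Gamma)$ is the full subgraph spanned by $x$ and all vertices adjacent to $x$. A trickle graph is a quadruple $(\Gamma,\le,\mu,(\varphi_x)_{x\in V(\Gamma)})$ where $\Gamma$ is a simplicial graph, $\le$ is a partial order on $V(\Gamma)$, $\mu:V(\Gamma)\to\mathbb N_{\ge 2}\cup\{\infty\}$ is a labeling, and each $\varphi_x$ is a graph automorphism of $\mathrm{star}_x(\Gamma)$, such that, writing $x||y$ if $x\not\le y$ and $y\not\le x$, and $E_{||}(\Gamma)=\{\{x,y\}\in E(\Gamma)\mid x||y\}$: (a) if $x<y$ then $\{x,y\}\in E(\Gamma)$; (b) if $\{x,y\}\in E_{||}(\Gamma)$ and $z\le y$, then $\{x,z\}\in E_{||}(\Gamma)$; (c) for all $x$ and all $y,z\in \mathrm{star}_x(\Gamma)$: $z\le y$ iff $\varphi_x(z)\le\varphi_x(y)$; (d) for all $x$ and $y\in\mathrm{star}_x(\Gamma)$: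 if $\varphi_x(y)\ne y$ then $y<x$; (e) if $\mu(x)$ is finite, then $\varphi_x$ has finite order dividing $\mu(x)$; (f) $\mu(\varphi_x(y))=\mu(y)$ for all $x$ and $y\in \mathrm{star}_x(\Gamma)$; (g) if $z<y<x$ then $(\varphi_x\circ\varphi_y)(z)=(\varphi_{y'}\circ\varphi_x)(z)$ where $y'=\varphi_x(y)$. The trickle group is $\mathrm{Tr}(\Gamma)=\langle V(\Gamma)\mid x^{\mu(x)}=1 \text{ if }\mu(x)\ne\infty,\ \varphi_x(y)\,x=\varphi_y(x)\,y\text{ for }\{x,y\}\in E(\Gamma)\rangle$. **Syllabic words.** $\mathbb Z_\mu=\mathbb Z/\mu\mathbb Z$ if $\mu\neq\infty$ and $\mathbb Z_\infty=\mathbb Z$. $S(\Gamma)=\{x^a\mid x\in V(\Gamma),\,a\in\mathbb Z_{\mu(x)}\setminus\{0\}\}$ is the set of syllables (formal symbols), and elements of the free monoid $S(\Gamma)^*$ are syllabic words, written as finite sequences. For $w=(x_1^{a_1},\dots,x_p^{a_p})$, $\overline w=x_1^{a_1}\cdots x_p^{a_p}\in\mathrm{Tr}(\Gamma)$ and $\lg(w)=p$. For $g\in\mathrm{Tr}(\Gamma)$, $\lg_{\rm syl}(g)$ is the smallest length of a syllabic word representing $g$; $w$ is syllabically reduced if $\lg(w)=\lg_{\rm syl}(\overline w)$. **Operations.** An operation of type I replaces, inside a syllabic word, a factor $(x^a,x^{-a})$ by the empty word, or a factor $(x^a,x^b)$ with $a+b\ne0$ in $\mathbb Z_{\mu(x)}$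 by $(x^{a+b})$. An operation of type II replaces a factor $(x^a,y^b)$, where $\{x,y\}\in E(\Gamma)$, by $(\varphi_x^a(y)^b,\ \varphi_y^{-b}(x)^a)$. An operation of type M is one of type I or II. A syllabic word $w$ is syllabically $M$-reduced if no word $w'$ obtained from $w$ by a finite sequence of type M operations satisfies $\lg(w')<\lg(w)$. *)

theory Defs
  imports
    "HOL-Algebra.Bij"
    "HOL-Algebra.Multiplicative_Group"
    "HOL-Algebra.Elementary_Groups"
    "HOL-Library.Extended_Nat"
begin

section \<open>Group presentations\<close>

text \<open>Group words over \<open>X\<close>: the letter \<open>(x, True)\<close> stands for \<open>x\<close> and
  \<open>(x, False)\<close> for the formal inverse of \<open>x\<close>. A pair \<open>(u, v)\<close> in a set of relations
  stands for the relation \<open>u = v\<close>.\<close>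

type_synonym 'a gword = "('a \<times> bool) list"

definition gwords :: "'a set \<Rightarrow> 'a gword set"
  where "gwords X = lists (X \<times> UNIV)"

inductive_set pres_rel :: "'a set \<Rightarrow> ('a gword \<times> 'a gword) set \<Rightarrow> ('a gword \<times> 'a gword) set"
  for X :: "'a set" and R :: "('a gword \<times> 'a gword) set"
  where
    refl: "u \<in> gwords X \<Longrightarrow> (u, u) \<in> pres_rel X R"
  | sym: "(u, v) \<in> pres_rel X R \<Longrightarrow> (v, u) \<in> pres_rel X R"
  | trans: "(u, v) \<in> pres_rel X R \<Longrightarrow> (v, w) \<in> pres_rel X R \<Longrightarrow> (u, w) \<in> pres_rel X R"
  | append: "(u, u') \<in> pres_rel X R \<Longrightarrow> (v, v') \<in> pres_rel X R \<Longrightarrow> (u @ v, u' @ v') \<in> pres_rel X R"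
  | cancel: "x \<in> X \<Longrightarrow> ([(x, e), (x, \<not> e)], []) \<in> pres_rel X R"
  | relation: "(u, v) \<in> R \<Longrightarrow> u \<in> gwords X \<Longrightarrow> v \<in> gwords X \<Longrightarrow> (u, v) \<in> pres_rel X R"

definition presented_group :: "'a set \<Rightarrow> ('a gword \<times> 'a gword) set \<Rightarrow> 'a gword set monoid"
  where "presented_group X R =
    \<lparr>carrier = gwords X // pres_rel X R,
     mult = \<lambda>A B. \<Union>u\<in>A. \<Union>v\<in>B. pres_rel X R `` {u @ v},
     one = pres_rel X R `` {[]}\<rparr>"

definition pres_gen :: "'a set \<Rightarrow> ('a gword \<times> 'a gword) set \<Rightarrow> 'a \<Rightarrow> 'a gword set"
  where "pres_gen X R x = pres_rel X R `` {[(x, True)]}"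

lemma pres_rel_gwords: "(u, v) \<in> pres_rel X R \<Longrightarrow> u \<in> gwords X \<and> v \<in> gwords X"
  by (induction rule: pres_rel.induct) (auto simp: gwords_def)

lemma equiv_pres_rel: "equiv (gwords X) (pres_rel X R)"
proof (rule equivI)
  show "pres_rel X R \<subseteq> gwords X \<times> gwords X"
    using pres_rel_gwords by auto
  show "refl_on (gwords X) (pres_rel X R)"
    by (auto simp: refl_on_def intro: pres_rel.refl)
  show "sym (pres_rel X R)"
    by (auto intro: symI pres_rel.sym)
  show "trans (pres_rel X R)"
    by (auto intro: transI pres_rel.trans)
qed

lemma mult_pres_class:
  assumes "u \<in> gwords X" "v \<in> gwords X"
  shows "pres_rel X R `` {u} \<otimes>\<^bsub>presented_group X R\<^esub> pres_rel X R `` {v} = pres_rel X R `` {u @ v}"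
proof -
  have eq: "pres_rel X R `` {u' @ v'} = pres_rel X R `` {u @ v}"
    if "u' \<in> pres_rel X R `` {u}" "v' \<in> pres_rel X R `` {v}" for u' v'
  proof -
    have "(u, u') \<in> pres_rel X R" "(v, v') \<in> pres_rel X R"
      using that by simp_all
    then have "(u @ v, u' @ v') \<in> pres_rel X R"
      by (rule pres_rel.append)
    from equiv_class_eq[OF equiv_pres_rel this] show ?thesis
      by (rule HOL.sym)
  qed
  have mem: "u \<in> pres_rel X R `` {u}" "v \<in> pres_rel X R `` {v}"
    using assms by (simp_all add: pres_rel.refl)
  have "(\<Union>u'\<in>pres_rel X R `` {u}. \<Union>v'\<in>pres_rel X R `` {v}. pres_rel X R `` {u' @ v'}) =
    (\<Union>u'\<in>pres_rel X R `` {u}. \<Union>v'\<in>pres_rel X R `` {v}. pres_rel X R `` {u @ v})"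
    by (rule SUP_cong[OF HOL.refl SUP_cong[OF HOL.refl eq]])
  also have "\<dots> = pres_rel X R `` {u @ v}"
    using mem by (metis UN_constant empty_iff)
  finally show ?thesis
    by (simp add: presented_group_def)
qed

lemma pres_class_inverse:
  assumes "u \<in> gwords X"
  shows "\<exists>v \<in> gwords X. (v @ u, []) \<in> pres_rel X R"
  using assms
proof (induction u)
  case Nil
  then show ?case
    by (auto simp: gwords_def intro!: bexI[of _ "[]"] pres_rel.refl)
next
  case (Cons l u)
  obtain x e where l: "l = (x, e)" by (cases l)
  have x: "x \<in> X" and u: "u \<in> gwords X"
    using Cons.prems by (auto simp: gwords_def l)
  from Cons.IH[OF u] obtain v where v: "v \<in> gwords X" "(v @ u, []) \<in> pres_rel X R"
    by blast
  have "([(x, \<not> e), (x, e)], []) \<in> pres_rel X R"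
    using pres_rel.cancel[OF x, of "\<not> e" R] by simp
  then have "([(x, \<not> e), (x, e)] @ u, [] @ u) \<in> pres_rel X R"
    using u by (intro pres_rel.append pres_rel.refl)
  then have "(v @ [(x, \<not> e), (x, e)] @ u, v @ [] @ u) \<in> pres_rel X R"
    using v(1) by (intro pres_rel.append[of v v] pres_rel.refl)
  then have "((v @ [(x, \<not> e)]) @ l # u, []) \<in> pres_rel X R"
    using v(2) pres_rel.trans by (fastforce simp: l)
  moreover have "v @ [(x, \<not> e)] \<in> gwords X"
    using v(1) x by (auto simp: gwords_def)
  ultimately show ?case by blast
qed

theorem group_presented_group: "group (presented_group X R)"
proof (rule groupI)
  let ?G = "presented_group X R"
  let ?c = "\<lambda>u. pres_rel X R `` {u}"
  have carI: "?c u \<in> carrier ?G" if "u \<in> gwords X" for u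
    using that unfolding presented_group_def by (simp add: quotientI)
  have carE: "\<exists>u\<in>gwords X. A = ?c u" if "A \<in> carrier ?G" for A
    using that unfolding presented_group_def by (simp add: quotient_def)
  have nil: "[] \<in> gwords X" and app: "\<And>u v. u \<in> gwords X \<Longrightarrow> v \<in> gwords X \<Longrightarrow> u @ v \<in> gwords X"
    by (simp_all add: gwords_def)
  have one: "\<one>\<^bsub>?G\<^esub> = ?c []"
    by (simp add: presented_group_def)
  show "\<one>\<^bsub>?G\<^esub> \<in> carrier ?G"
    unfolding one using nil by (rule carI)
  fix A assume "A \<in> carrier ?G"
  then obtain u where u: "u \<in> gwords X" "A = ?c u"
    using carE by blast
  show "\<one>\<^bsub>?G\<^esub> \<otimes>\<^bsub>?G\<^esub> A = A"
    using mult_pres_class[OF nil u(1), of R] by (simp only: one u(2) append_Nil)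
  obtain u' where u': "u' \<in> gwords X" "(u' @ u, []) \<in> pres_rel X R"
    using pres_class_inverse[OF u(1)] by blast
  have "?c u' \<otimes>\<^bsub>?G\<^esub> A = \<one>\<^bsub>?G\<^esub>"
    using mult_pres_class[OF u'(1) u(1), of R] equiv_class_eq[OF equiv_pres_rel u'(2)]
    by (simp only: one u(2))
  then show "\<exists>B\<in>carrier ?G. B \<otimes>\<^bsub>?G\<^esub> A = \<one>\<^bsub>?G\<^esub>"
    using carI[OF u'(1)] by (rule bexI)
  fix B assume "B \<in> carrier ?G"
  then obtain v where v: "v \<in> gwords X" "B = ?c v"
    using carE by blast
  show "A \<otimes>\<^bsub>?G\<^esub> B \<in> carrier ?G"
    unfolding u(2) v(2) mult_pres_class[OF u(1) v(1)] using u(1) v(1) by (intro carI app)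
  fix C assume "C \<in> carrier ?G"
  then obtain w where w: "w \<in> gwords X" "C = ?c w"
    using carE by blast
  show "A \<otimes>\<^bsub>?G\<^esub> B \<otimes>\<^bsub>?G\<^esub> C = A \<otimes>\<^bsub>?G\<^esub> (B \<otimes>\<^bsub>?G\<^esub> C)"
    using u(1) v(1) w(1) by (simp only: u(2) v(2) w(2) mult_pres_class app append_assoc)
qed


section \<open>Trickle graphs\<close>

text \<open>The partial order is the relation \<open>vle \<Gamma>\<close>, where \<open>(x, y) \<in> vle \<Gamma>\<close> means \<open>x \<le> y\<close>. Edges are
  unordered pairs \<open>{x, y}\<close>.\<close>

record 'v trickle =
  verts :: "'v set"
  edges :: "'v set set"
  vle :: "'v rel"
  vlabel :: "'v \<Rightarrow> enat"
  vaut :: "'v \<Rightarrow> 'v \<Rightarrow> 'v"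

text \<open>The vertex set of the star of \<open>x\<close>; its edges are all edges of \<open>\<Gamma>\<close> between its vertices.\<close>

definition star :: "('v, 'b) trickle_scheme \<Rightarrow> 'v \<Rightarrow> 'v set"
  where "star \<Gamma> x = insert x {y \<in> verts \<Gamma>. {x, y} \<in> edges \<Gamma>}"

definition vless :: "('v, 'b) trickle_scheme \<Rightarrow> 'v \<Rightarrow> 'v \<Rightarrow> bool"
  where "vless \<Gamma> x y \<longleftrightarrow> (x, y) \<in> vle \<Gamma> \<and> x \<noteq> y"

definition par_edges :: "('v, 'b) trickle_scheme \<Rightarrow> 'v set set"
  where "par_edges \<Gamma> = {{x, y} | x y. {x, y} \<in> edges \<Gamma> \<and> (x, y) \<notin> vle \<Gamma> \<and> (y, x) \<notin> vle \<Gamma>}"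

text \<open>The graph automorphisms of the star of \<open>x\<close>, as a subset of the library's group
  \<^term>\<open>BijGroup (star \<Gamma> x)\<close> of bijections, whose elements are \<^const>\<open>undefined\<close> off the star.\<close>

definition star_auts :: "('v, 'b) trickle_scheme \<Rightarrow> 'v \<Rightarrow> ('v \<Rightarrow> 'v) set"
  where "star_auts \<Gamma> x = {f \<in> carrier (BijGroup (star \<Gamma> x)).
    \<forall>y \<in> star \<Gamma> x. \<forall>z \<in> star \<Gamma> x. {y, z} \<in> edges \<Gamma> \<longleftrightarrow> {f y, f z} \<in> edges \<Gamma>}"

locale trickle_graph =
  fixes \<Gamma> :: "('v, 'b) trickle_scheme" (structure)
  assumes edges: "edges \<Gamma> \<subseteq> {{x, y} | x y. x \<in> verts \<Gamma> \<and> y \<in> verts \<Gamma> \<and> x \<noteq> y}"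
    and order: "partial_order_on (verts \<Gamma>) (vle \<Gamma>)"
    and label: "\<And>x. x \<in> verts \<Gamma> \<Longrightarrow> 2 \<le> vlabel \<Gamma> x"
    and aut: "\<And>x. x \<in> verts \<Gamma> \<Longrightarrow> vaut \<Gamma> x \<in> star_auts \<Gamma> x"
    and less_edge: "\<And>x y. vless \<Gamma> x y \<Longrightarrow> {x, y} \<in> edges \<Gamma>"
    and par_down: "\<And>x y z. {x, y} \<in> par_edges \<Gamma> \<Longrightarrow> (z, y) \<in> vle \<Gamma> \<Longrightarrow> {x, z} \<in> par_edges \<Gamma>"
    and aut_mono: "\<And>x y z. x \<in> verts \<Gamma> \<Longrightarrow> y \<in> star \<Gamma> x \<Longrightarrow> z \<in> star \<Gamma> x \<Longrightarrow>
      (z, y) \<in> vle \<Gamma> \<longleftrightarrow> (vaut \<Gamma> x z, vaut \<Gamma> x y) \<in> vle \<Gamma>"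
    and aut_moves: "\<And>x y. x \<in> verts \<Gamma> \<Longrightarrow> y \<in> star \<Gamma> x \<Longrightarrow> vaut \<Gamma> x y \<noteq> y \<Longrightarrow> vless \<Gamma> y x"
    \<comment> \<open>\<open>group.ord\<close> is 0 for elements of infinite order, and 0 does not divide \<open>n \<ge> 2\<close>.\<close>
    and aut_order: "\<And>x n. x \<in> verts \<Gamma> \<Longrightarrow> vlabel \<Gamma> x = enat n \<Longrightarrow>
      group.ord (BijGroup (star \<Gamma> x)) (vaut \<Gamma> x) dvd n"
    and aut_label: "\<And>x y. x \<in> verts \<Gamma> \<Longrightarrow> y \<in> star \<Gamma> x \<Longrightarrow> vlabel \<Gamma> (vaut \<Gamma> x y) = vlabel \<Gamma> y"
    and aut_aut: "\<And>x y z. vless \<Gamma> z y \<Longrightarrow> vless \<Gamma> y x \<Longrightarrow>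
      vaut \<Gamma> x (vaut \<Gamma> y z) = vaut \<Gamma> (vaut \<Gamma> x y) (vaut \<Gamma> x z)"

definition trickle_relations :: "('v, 'b) trickle_scheme \<Rightarrow> ('v gword \<times> 'v gword) set"
  where "trickle_relations \<Gamma> =
    {(replicate n (x, True), []) | x n. x \<in> verts \<Gamma> \<and> vlabel \<Gamma> x = enat n} \<union>
    {([(vaut \<Gamma> x y, True), (x, True)], [(vaut \<Gamma> y x, True), (y, True)]) | x y. {x, y} \<in> edges \<Gamma>}"

definition trickle_group :: "('v, 'b) trickle_scheme \<Rightarrow> 'v gword set monoid"
  where "trickle_group \<Gamma> = presented_group (verts \<Gamma>) (trickle_relations \<Gamma>)"

definition trickle_gen :: "('v, 'b) trickle_scheme \<Rightarrow> 'v \<Rightarrow> 'v gword set"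
  where "trickle_gen \<Gamma> = pres_gen (verts \<Gamma>) (trickle_relations \<Gamma>)"


section \<open>Syllabic words\<close>

text \<open>\<^term>\<open>integer_mod_group n\<close> has carrier \<open>{0..<n}\<close>, and is the group of integers for \<open>n = 0\<close>.
  A syllable \<open>x\<^sup>a\<close> is a pair \<open>(x, a)\<close>, with \<open>a\<close> the representative in that carrier.\<close>

definition exp_group :: "('v, 'b) trickle_scheme \<Rightarrow> 'v \<Rightarrow> int monoid"
  where "exp_group \<Gamma> x = (case vlabel \<Gamma> x of enat n \<Rightarrow> integer_mod_group n | \<infinity> \<Rightarrow> integer_group)"

definition syllables :: "('v, 'b) trickle_scheme \<Rightarrow> ('v \<times> int) set"
  where "syllables \<Gamma> =
    {(x, a). x \<in> verts \<Gamma> \<and> a \<in> carrier (exp_group \<Gamma> x) - {\<one>\<^bsub>exp_group \<Gamma> x\<^esub>}}"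

definition syllabic_words :: "('v, 'b) trickle_scheme \<Rightarrow> ('v \<times> int) list set"
  where "syllabic_words \<Gamma> = lists (syllables \<Gamma>)"

definition syl_eval :: "('v, 'b) trickle_scheme \<Rightarrow> ('v \<times> int) list \<Rightarrow> 'v gword set"
  where "syl_eval \<Gamma> w =
    foldr (\<lambda>(x, a) g. (trickle_gen \<Gamma> x [^]\<^bsub>trickle_group \<Gamma>\<^esub> a) \<otimes>\<^bsub>trickle_group \<Gamma>\<^esub> g)
      w \<one>\<^bsub>trickle_group \<Gamma>\<^esub>"

definition syl_length :: "('v, 'b) trickle_scheme \<Rightarrow> 'v gword set \<Rightarrow> nat"
  where "syl_length \<Gamma> g = (LEAST n. \<exists>w \<in> syllabic_words \<Gamma>. syl_eval \<Gamma> w = g \<and> length w = n)"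

definition syl_reduced :: "('v, 'b) trickle_scheme \<Rightarrow> ('v \<times> int) list \<Rightarrow> bool"
  where "syl_reduced \<Gamma> w \<longleftrightarrow> length w = syl_length \<Gamma> (syl_eval \<Gamma> w)"

definition vaut_pow :: "('v, 'b) trickle_scheme \<Rightarrow> 'v \<Rightarrow> int \<Rightarrow> 'v \<Rightarrow> 'v"
  where "vaut_pow \<Gamma> x a = vaut \<Gamma> x [^]\<^bsub>BijGroup (star \<Gamma> x)\<^esub> a"

inductive_set op_I :: "('v, 'b) trickle_scheme \<Rightarrow> (('v \<times> int) list \<times> ('v \<times> int) list) set"
  for \<Gamma> :: "('v, 'b) trickle_scheme"
  where
    cancel: "u @ [(x, a), (x, b)] @ v \<in> syllabic_words \<Gamma> \<Longrightarrow> b = inv\<^bsub>exp_group \<Gamma> x\<^esub> a \<Longrightarrow>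
      (u @ [(x, a), (x, b)] @ v, u @ v) \<in> op_I \<Gamma>"
  | merge: "u @ [(x, a), (x, b)] @ v \<in> syllabic_words \<Gamma> \<Longrightarrow>
      a \<otimes>\<^bsub>exp_group \<Gamma> x\<^esub> b \<noteq> \<one>\<^bsub>exp_group \<Gamma> x\<^esub> \<Longrightarrow>
      (u @ [(x, a), (x, b)] @ v, u @ [(x, a \<otimes>\<^bsub>exp_group \<Gamma> x\<^esub> b)] @ v) \<in> op_I \<Gamma>"

inductive_set op_II :: "('v, 'b) trickle_scheme \<Rightarrow> (('v \<times> int) list \<times> ('v \<times> int) list) set"
  for \<Gamma> :: "('v, 'b) trickle_scheme"
  where
    "u @ [(x, a), (y, b)] @ v \<in> syllabic_words \<Gamma> \<Longrightarrow> {x, y} \<in> edges \<Gamma> \<Longrightarrow>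
      (u @ [(x, a), (y, b)] @ v,
       u @ [(vaut_pow \<Gamma> x a y, b), (vaut_pow \<Gamma> y (- b) x, a)] @ v) \<in> op_II \<Gamma>"

definition M_reduced :: "('v, 'b) trickle_scheme \<Rightarrow> ('v \<times> int) list \<Rightarrow> bool"
  where "M_reduced \<Gamma> w \<longleftrightarrow> \<not> (\<exists>w'. (w, w') \<in> (op_I \<Gamma> \<union> op_II \<Gamma>)\<^sup>* \<and> length w' < length w)"

end

theory Submission
  imports Defs
begin

text \<open>
  Call a word irreducible if operations of type II never bring two syllables at the same vertex
  next to each other, so that operations of type I cannot come into play. The hard part is that two
  irreducible words with the same value differ only by operations of type II. As in the proof of
  the normal form theorem for free products, the trickle group is made to act on the irreducible
  words, taken up to operations of type II, in such a way that a word sends the empty word to its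
  own class; the class is then determined by the value.

  Three observations make the action work.

  \<^item> The automorphisms \<open>\<phi>\<^sub>x\<close> move only vertices below \<open>x\<close>, so they extend by the identity to
    permutations of all vertices (\<open>twist\<close>). In this form the compatibility of \<open>\<phi>\<^sub>x\<close> and \<open>\<phi>\<^sub>y\<close>
    that is required for \<open>y < x\<close> becomes an identity of permutations valid for any two adjacent
    vertices (\<open>twist_exchange\<close>), and no domains have to be followed any longer. It makes the operation of type II an involutive solution of the braid
    equation on three syllables (\<open>braid\<close>).

  \<^item> Because of the braid equation, the ways of pulling a syllable to the front of a word do not
    change under operations of type II (\<open>pull_swap\<close>). Hence a class of words has at most one
    leading syllable at a given vertex, and the rest is determined by it (\<open>head_unique\<close>); leading
    syllables at distinct vertices come from one another by an exchange (\<open>head_exchange\<close>).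

  \<^item> If no word equivalent to the irreducible word \<open>w\<close> starts at the vertex \<open>x\<close>, then the word
    \<open>(x, a) # w\<close> is irreducible too (\<open>merge_free_Cons\<close>).

  So every irreducible class is \<open>x\<^sup>b w'\<close> for a unique exponent \<open>b\<close>, possibly zero, and a unique
  class \<open>w'\<close> without leading syllable at \<open>x\<close>; the generator \<open>x\<close> acts by adding 1 to \<open>b\<close>. The powers
  of \<open>x\<close> act correctly by construction, and the exchange relations follow by splitting off the
  leading syllables at two adjacent vertices simultaneously (\<open>act_exchange\<close>). By induction over the
  congruence that defines the presented group, equal elements act equally, which gives
  \<open>eqv_of_syl_eval_eq\<close>. Since the operations do not change the value of a word, a shortest word is
  irreducible, and both parts of the theorem follow.
\<close>

section \<open>Exchange relations for powers in a group\<close>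

text \<open>A relation between generators carries over to all integer powers: if \<open>c\<close> conjugates \<open>u 1\<close> to
  \<open>v 1\<close>, it conjugates the one-parameter family \<open>u\<close> to \<open>v\<close>. Families are
  homomorphisms from the integers rather than powers of an element, since the permutations
  \<open>twist x k\<close> below are defined for each \<open>k\<close> separately.\<close>

lemma (in group) intertwine_powers:
  fixes u v :: "int \<Rightarrow> 'a"
  assumes c: "c \<in> carrier G"
    and u: "\<And>k. u k \<in> carrier G" "\<And>k l. u (k + l) = u k \<otimes> u l"
    and v: "\<And>k. v k \<in> carrier G" "\<And>k l. v (k + l) = v k \<otimes> v l"
    and step: "c \<otimes> u 1 = v 1 \<otimes> c"
  shows "c \<otimes> u k = v k \<otimes> c"
proof (induction k rule: int_induct[where k = 0])
  case base
  have "u 0 = \<one>" "v 0 = \<one>"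
    using u v by (metis add_0 r_cancel_one')+
  then show ?case using c by simp
next
  case (step1 i)
  have "c \<otimes> u (i + 1) = v i \<otimes> (c \<otimes> u 1)"
    using step1 c u v by (simp add: m_assoc[symmetric])
  also have "\<dots> = v (i + 1) \<otimes> c"
    using step c u v by (simp add: m_assoc)
  finally show ?case .
next
  case (step2 i)
  have "v 1 \<otimes> (c \<otimes> u (i - 1)) = c \<otimes> (u 1 \<otimes> u (i - 1))"
    using step c u v by (simp add: m_assoc[symmetric])
  also have "\<dots> = v (1 + (i - 1)) \<otimes> c"
    using step2 u(2)[of 1 "i - 1"] by simp
  also have "\<dots> = v 1 \<otimes> (v (i - 1) \<otimes> c)"
    using v c by (simp only: v(2) m_assoc)
  finally show ?case
    using c u v by simp
qed

lemma (in group) intertwine_cancel_left: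
  assumes "c \<in> carrier G" "d \<in> carrier G" "u \<in> carrier G" "v \<in> carrier G" "w \<in> carrier G"
    and "c \<otimes> v = w \<otimes> c" "(c \<otimes> d) \<otimes> u = w \<otimes> (c \<otimes> d)"
  shows "d \<otimes> u = v \<otimes> d"
proof -
  have "c \<otimes> (d \<otimes> u) = c \<otimes> (v \<otimes> d)"
    using assms by (simp add: m_assoc[symmetric])
  then show ?thesis using assms by simp
qed

context trickle_graph
begin

section \<open>Order and adjacency\<close>

definition adj :: "'v \<Rightarrow> 'v \<Rightarrow> bool"
  where "adj x y \<longleftrightarrow> {x, y} \<in> edges \<Gamma>"

lemma adj_sym: "adj x y \<Longrightarrow> adj y x"
  by (simp add: adj_def insert_commute)

lemma adj_vertsD: "adj x y \<Longrightarrow> x \<in> verts \<Gamma> \<and> y \<in> verts \<Gamma> \<and> x \<noteq> y"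
  using edges unfolding adj_def by (auto simp: doubleton_eq_iff)

lemma vless_adj: "vless \<Gamma> x y \<Longrightarrow> adj x y"
  by (simp add: adj_def less_edge)

lemma vless_irrefl: "\<not> vless \<Gamma> x x"
  by (simp add: vless_def)

lemma vle_trans: "(x, y) \<in> vle \<Gamma> \<Longrightarrow> (y, z) \<in> vle \<Gamma> \<Longrightarrow> (x, z) \<in> vle \<Gamma>"
  using order unfolding partial_order_on_def preorder_on_def by (meson transD)

lemma vle_antisym: "(x, y) \<in> vle \<Gamma> \<Longrightarrow> (y, x) \<in> vle \<Gamma> \<Longrightarrow> x = y"
  using order unfolding partial_order_on_def by (meson antisymD)

lemma vless_trans: "vless \<Gamma> x y \<Longrightarrow> vless \<Gamma> y z \<Longrightarrow> vless \<Gamma> x z"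
  unfolding vless_def using vle_trans vle_antisym by blast

lemma vless_asym: "vless \<Gamma> x y \<Longrightarrow> \<not> vless \<Gamma> y x"
  unfolding vless_def using vle_antisym by blast

text \<open>Incomparability of adjacent vertices propagates downwards by \<open>par_down\<close>, so a common lower bound
  would be incomparable to the vertices above it.\<close>

lemma incomparable_down:
  assumes "adj x y" "\<not> vless \<Gamma> x y" "\<not> vless \<Gamma> y x" "vless \<Gamma> z x"
  shows "\<not> vless \<Gamma> z y"
proof -
  have "x \<noteq> y" using assms(1) adj_vertsD by blast
  then have "{y, x} \<in> par_edges \<Gamma>"
    using assms adj_sym unfolding par_edges_def vless_def adj_def by blast
  then have "{y, z} \<in> par_edges \<Gamma>"
    using par_down assms(4) unfolding vless_def by blast
  then show ?thesis
    unfolding par_edges_def vless_def by (auto simp: doubleton_eq_iff)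
qed

lemma star_iff: "x \<in> verts \<Gamma> \<Longrightarrow> y \<in> star \<Gamma> x \<longleftrightarrow> y = x \<or> adj x y"
  using adj_vertsD unfolding star_def adj_def by blast


section \<open>The automorphisms as permutations of all vertices\<close>

text \<open>The automorphisms of a star with the properties that the axioms demand of \<open>\<phi>\<^sub>x\<close>. They form a
  group, which is how the properties pass to the powers of \<open>\<phi>\<^sub>x\<close>.\<close>

definition trickle_auts :: "'v \<Rightarrow> ('v \<Rightarrow> 'v) set"
  where "trickle_auts x = {f \<in> star_auts \<Gamma> x.
    (\<forall>y \<in> star \<Gamma> x. \<forall>z \<in> star \<Gamma> x. (y, z) \<in> vle \<Gamma> \<longleftrightarrow> (f y, f z) \<in> vle \<Gamma>) \<and>
    (\<forall>y \<in> star \<Gamma> x. vlabel \<Gamma> (f y) = vlabel \<Gamma> y \<and> (f y \<noteq> y \<longrightarrow> vless \<Gamma> y x))}"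

lemma BijGroup_apply:
  assumes "f \<in> carrier (BijGroup S)" "g \<in> carrier (BijGroup S)" "y \<in> S"
  shows "(f \<otimes>\<^bsub>BijGroup S\<^esub> g) y = f (g y)" "f y \<in> S"
  using assms by (auto simp: BijGroup_def compose_def Bij_def bij_betw_def)

lemma subgroup_trickle_auts:
  assumes x: "x \<in> verts \<Gamma>"
  shows "subgroup (trickle_auts x) (BijGroup (star \<Gamma> x))"
proof -
  interpret B: group "BijGroup (star \<Gamma> x)" by (rule group_BijGroup)
  let ?S = "star \<Gamma> x"
  note app = BijGroup_apply[where S = ?S]
  have xS: "x \<in> ?S" by (simp add: star_def)
  have car: "trickle_auts x \<subseteq> carrier (BijGroup ?S)"
    by (auto simp: trickle_auts_def star_auts_def)
  show ?thesis
  proof (rule B.subgroupI[OF car])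
    have "vaut \<Gamma> x \<in> trickle_auts x"
      using aut[OF x] aut_mono[OF x] aut_moves[OF x] aut_label[OF x]
      unfolding trickle_auts_def by blast
    then show "trickle_auts x \<noteq> {}" by blast
  next
    fix f g assume f: "f \<in> trickle_auts x" and g: "g \<in> trickle_auts x"
    then have fg: "f \<in> carrier (BijGroup ?S)" "g \<in> carrier (BijGroup ?S)"
      using car by auto
    have [simp]: "(f \<otimes>\<^bsub>BijGroup ?S\<^esub> g) y = f (g y)" "g y \<in> ?S" if "y \<in> ?S" for y
      using app fg that by auto
    have mv: "f (g y) \<noteq> y \<Longrightarrow> y \<in> ?S \<Longrightarrow> vless \<Gamma> y x" for y
      using f g by (cases "g y = y") (auto simp: trickle_auts_def)
    show "f \<otimes>\<^bsub>BijGroup ?S\<^esub> g \<in> trickle_auts x"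
      using f g mv fg B.m_closed unfolding trickle_auts_def star_auts_def by simp
  next
    fix f assume f: "f \<in> trickle_auts x"
    then have fc: "f \<in> carrier (BijGroup ?S)" using car by auto
    define g where "g = inv\<^bsub>BijGroup ?S\<^esub> f"
    have gc: "g \<in> carrier (BijGroup ?S)" using fc by (simp add: g_def)
    have fg: "f (g y) = y" and gf: "g (f y) = y" and gS: "g y \<in> ?S" and fS: "f y \<in> ?S"
      if "y \<in> ?S" for y
    proof -
      have "f \<otimes>\<^bsub>BijGroup ?S\<^esub> g = \<one>\<^bsub>BijGroup ?S\<^esub>" "g \<otimes>\<^bsub>BijGroup ?S\<^esub> f = \<one>\<^bsub>BijGroup ?S\<^esub>"
        using fc by (simp_all add: g_def)
      moreover have "\<one>\<^bsub>BijGroup ?S\<^esub> y = y" using that by (simp add: BijGroup_def)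
      ultimately show "f (g y) = y" "g (f y) = y" "g y \<in> ?S" "f y \<in> ?S"
        using app fc gc that by metis+
    qed
    have fx: "f x = x"
      using f xS vless_irrefl unfolding trickle_auts_def by blast
    \<comment> \<open>Only \<open>g y\<close> is known to lie below \<open>x\<close>; monotonicity of \<open>f\<close>, which fixes \<open>x\<close>, transports
      this to \<open>y = f (g y)\<close>.\<close>
    have mv: "vless \<Gamma> y x" if "y \<in> ?S" "g y \<noteq> y" for y
    proof -
      have "f (g y) \<noteq> g y" using fg that by simp
      then have "vless \<Gamma> (g y) x" using f gS that(1) unfolding trickle_auts_def by blast
      then have "(f (g y), f x) \<in> vle \<Gamma>"
        using f gS[OF that(1)] xS unfolding trickle_auts_def vless_def by blast
      moreover have "y \<noteq> x" using that fx gf xS by metis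
      ultimately show ?thesis using fg[OF that(1)] fx by (simp add: vless_def)
    qed
    show "inv\<^bsub>BijGroup ?S\<^esub> f \<in> trickle_auts x"
      unfolding g_def[symmetric] trickle_auts_def star_auts_def
    proof (intro CollectI conjI ballI impI gc mv)
      fix y z assume yz: "y \<in> ?S" "z \<in> ?S"
      have "{f (g y), f (g z)} \<in> edges \<Gamma> \<longleftrightarrow> {g y, g z} \<in> edges \<Gamma>"
        using f gS yz unfolding trickle_auts_def star_auts_def by blast
      then show "{y, z} \<in> edges \<Gamma> \<longleftrightarrow> {g y, g z} \<in> edges \<Gamma>"
        using fg yz by simp
      have "(f (g y), f (g z)) \<in> vle \<Gamma> \<longleftrightarrow> (g y, g z) \<in> vle \<Gamma>"
        using f gS yz unfolding trickle_auts_def by blast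
      then show "(y, z) \<in> vle \<Gamma> \<longleftrightarrow> (g y, g z) \<in> vle \<Gamma>"
        using fg yz by simp
    next
      fix y assume y: "y \<in> ?S"
      have "vlabel \<Gamma> (f (g y)) = vlabel \<Gamma> (g y)"
        using f gS y unfolding trickle_auts_def by blast
      then show "vlabel \<Gamma> (g y) = vlabel \<Gamma> y" using fg y by simp
    qed
  qed
qed

lemma vaut_pow_trickle_auts:
  assumes x: "x \<in> verts \<Gamma>"
  shows "vaut_pow \<Gamma> x k \<in> trickle_auts x"
proof -
  have "vaut \<Gamma> x \<in> trickle_auts x"
    using aut[OF x] aut_mono[OF x] aut_moves[OF x] aut_label[OF x]
    unfolding trickle_auts_def by blast
  then show ?thesis
    unfolding vaut_pow_def
    by (rule group.subgroup_int_pow_closed[OF group_BijGroup subgroup_trickle_auts[OF x]])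
qed

text \<open>The power \<open>\<phi>\<^sub>x\<^sup>k\<close>, extended by the identity to all vertices. Since \<open>\<phi>\<^sub>x\<close> moves only vertices
  below \<open>x\<close>, this agrees with \<open>\<phi>\<^sub>x\<^sup>k\<close> on the whole star.\<close>

definition twist :: "'v \<Rightarrow> int \<Rightarrow> 'v \<Rightarrow> 'v"
  where "twist x k z = (if vless \<Gamma> z x then vaut_pow \<Gamma> x k z else z)"

lemma twist_vaut_pow:
  assumes "x \<in> verts \<Gamma>" "z \<in> star \<Gamma> x"
  shows "vaut_pow \<Gamma> x k z = twist x k z"
  using vaut_pow_trickle_auts[OF assms(1), of k] assms(2)
  by (auto simp: twist_def trickle_auts_def)

lemma twist_fixes: "\<not> vless \<Gamma> z x \<Longrightarrow> twist x k z = z"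
  by (simp add: twist_def)

lemma twist_above: "vless \<Gamma> x z \<Longrightarrow> twist x k z = z"
  by (intro twist_fixes vless_asym)

context
  fixes x assumes x: "x \<in> verts \<Gamma>"
begin

lemma star_self: "x \<in> star \<Gamma> x"
  by (simp add: star_def)

lemma vless_star: "vless \<Gamma> z x \<Longrightarrow> z \<in> star \<Gamma> x"
  using star_iff[OF x] vless_adj adj_sym by blast

lemma twist_star:
  assumes "y \<in> star \<Gamma> x"
  shows "twist x k y \<in> star \<Gamma> x"
  using vaut_pow_trickle_auts[OF x, of k] twist_vaut_pow[OF x assms, of k]
    BijGroup_apply(2)[OF _ _ assms, of "vaut_pow \<Gamma> x k" "vaut_pow \<Gamma> x k"]
  by (auto simp: trickle_auts_def star_auts_def)

lemma twist_adj_iff: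
  assumes "y \<in> star \<Gamma> x" "z \<in> star \<Gamma> x"
  shows "adj (twist x k y) (twist x k z) \<longleftrightarrow> adj y z"
  using vaut_pow_trickle_auts[OF x, of k] twist_vaut_pow[OF x, of _ k] assms
  unfolding adj_def trickle_auts_def star_auts_def by force

lemma twist_vle_iff:
  assumes "y \<in> star \<Gamma> x" "z \<in> star \<Gamma> x"
  shows "(twist x k y, twist x k z) \<in> vle \<Gamma> \<longleftrightarrow> (y, z) \<in> vle \<Gamma>"
  using vaut_pow_trickle_auts[OF x, of k] twist_vaut_pow[OF x, of _ k] assms
  unfolding trickle_auts_def by force

lemma twist_label: "vlabel \<Gamma> (twist x k y) = vlabel \<Gamma> y"
proof (cases "vless \<Gamma> y x")
  case True
  then show ?thesis
    using vaut_pow_trickle_auts[OF x, of k] vless_star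
    by (auto simp: twist_def trickle_auts_def)
qed (simp add: twist_fixes)

lemma twist_0: "twist x 0 z = z"
  using vless_star[of z] by (simp add: twist_def vaut_pow_def BijGroup_def)

lemma twist_below: "vless \<Gamma> y x \<Longrightarrow> vless \<Gamma> (twist x k y) x"
proof -
  assume y: "vless \<Gamma> y x"
  have fx: "twist x k x = x" by (simp add: twist_fixes vless_irrefl)
  have le: "(twist x k y, x) \<in> vle \<Gamma>"
    using twist_vle_iff[OF vless_star[OF y] star_self, of k] y fx by (simp add: vless_def)
  have "\<not> (x, y) \<in> vle \<Gamma>" using y vless_asym by (auto simp: vless_def dest: vle_antisym)
  then have "\<not> (x, twist x k y) \<in> vle \<Gamma>"
    using twist_vle_iff[OF star_self vless_star[OF y], of k] fx by simp
  with le y show ?thesis using vle_trans by (auto simp: vless_def)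
qed

lemma twist_add: "twist x (k + l) z = twist x k (twist x l z)"
proof (cases "vless \<Gamma> z x")
  case True
  interpret B: group "BijGroup (star \<Gamma> x)" by (rule group_BijGroup)
  have c: "vaut \<Gamma> x \<in> carrier (BijGroup (star \<Gamma> x))"
    using aut[OF x] by (simp add: star_auts_def)
  have "vaut_pow \<Gamma> x (k + l) z = vaut_pow \<Gamma> x k (vaut_pow \<Gamma> x l z)"
    using vless_star[OF True] c unfolding vaut_pow_def
    by (simp add: B.int_pow_mult BijGroup_apply)
  then show ?thesis
    using True twist_below[OF True, of l] by (simp add: twist_def)
qed (simp add: twist_fixes)

lemma twist_below_iff: "vless \<Gamma> (twist x k y) x \<longleftrightarrow> vless \<Gamma> y x"
  using twist_below twist_fixes by metis

lemma twist_inverse: "twist x (- k) (twist x k z) = z" "twist x k (twist x (- k) z) = z"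
  using twist_add[of "-k" k z] twist_add[of k "-k" z] twist_0 by simp_all

lemma twist_vless_iff:
  assumes "y \<in> star \<Gamma> x" "z \<in> star \<Gamma> x"
  shows "vless \<Gamma> (twist x k y) (twist x k z) \<longleftrightarrow> vless \<Gamma> y z"
  using twist_vle_iff[OF assms, of k] twist_inverse(1) unfolding vless_def by metis

lemma twist_verts: "z \<in> verts \<Gamma> \<Longrightarrow> twist x k z \<in> verts \<Gamma>"
  using twist_below vless_adj adj_vertsD twist_fixes by metis

lemma twist_1: "z \<in> star \<Gamma> x \<Longrightarrow> vaut \<Gamma> x z = twist x 1 z"
proof -
  assume z: "z \<in> star \<Gamma> x"
  have "vaut \<Gamma> x \<in> carrier (BijGroup (star \<Gamma> x))" using aut[OF x] by (simp add: star_auts_def)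
  then have "vaut_pow \<Gamma> x 1 = vaut \<Gamma> x"
    unfolding vaut_pow_def by (rule group.int_pow_1[OF group_BijGroup])
  then show ?thesis using twist_vaut_pow[OF x z, of 1] by simp
qed

end

lemma twist_adj: "adj x y \<Longrightarrow> adj x (twist x k y)"
  using star_iff twist_star adj_vertsD twist_inverse(1) twist_fixes vless_irrefl by metis

text \<open>Of two adjacent vertices at most one is moved by the other, which makes \<open>twist y b x\<close> act
  on \<open>y\<close> as \<open>x\<close> does.\<close>

lemma twist_twisted_index:
  assumes "adj x y"
  shows "twist (twist y b x) a y = twist x a y"
proof (cases "vless \<Gamma> x y")
  case True
  then have "vless \<Gamma> (twist y b x) y" using twist_below adj_vertsD assms by blast
  then show ?thesis using True by (simp add: twist_above)
qed (simp add: twist_fixes)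

lemma adj_below:
  assumes "adj x y" "\<not> vless \<Gamma> x y"
  shows "adj x (twist x k y) \<and> \<not> vless \<Gamma> x (twist x k y)"
  using twist_adj[OF assms(1)] twist_below_iff[of x k y] vless_asym twist_fixes assms adj_vertsD
  by metis

text \<open>The defining relations of the trickle group imply the exchange rule for arbitrary powers. The
  rule is used twice: for the generators of the trickle group, and for the permutations
  \<^const>\<open>twist\<close>, which satisfy the same relations (\<open>twist_conj_1\<close>).\<close>

lemma exchange_powers:
  assumes G: "group G"
    and car: "\<And>x k. x \<in> verts \<Gamma> \<Longrightarrow> h x k \<in> carrier G"
    and add: "\<And>x k l. x \<in> verts \<Gamma> \<Longrightarrow> h x (k + l) = h x k \<otimes>\<^bsub>G\<^esub> h x l"
    and rel: "\<And>x y. adj x y \<Longrightarrow> \<not> vless \<Gamma> x y \<Longrightarrow>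
      h x 1 \<otimes>\<^bsub>G\<^esub> h y 1 = h (twist x 1 y) 1 \<otimes>\<^bsub>G\<^esub> h x 1"
    and xy: "adj x y" "\<not> vless \<Gamma> x y"
  shows "h x a \<otimes>\<^bsub>G\<^esub> h y b = h (twist x a y) b \<otimes>\<^bsub>G\<^esub> h x a"
proof -
  interpret group G by (rule G)
  have x: "x \<in> verts \<Gamma>" and y: "\<And>k. twist x k y \<in> verts \<Gamma>"
    using adj_vertsD xy(1) twist_verts by blast+
  have rel1: "h x 1 \<otimes>\<^bsub>G\<^esub> h (twist x k y) b = h (twist x 1 (twist x k y)) b \<otimes>\<^bsub>G\<^esub> h x 1" for k b
  proof (rule intertwine_powers[where u = "h (twist x k y)" and v = "h (twist x 1 (twist x k y))"])
    have y1: "twist x 1 (twist x k y) \<in> verts \<Gamma>" using twist_verts[OF x y] .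
    show "h x 1 \<in> carrier G" by (rule car[OF x])
    show "h (twist x k y) i \<in> carrier G" "h (twist x 1 (twist x k y)) i \<in> carrier G" for i
      by (rule car[OF y], rule car[OF y1])
    show "h (twist x k y) (i + j) = h (twist x k y) i \<otimes>\<^bsub>G\<^esub> h (twist x k y) j"
      "h (twist x 1 (twist x k y)) (i + j) =
        h (twist x 1 (twist x k y)) i \<otimes>\<^bsub>G\<^esub> h (twist x 1 (twist x k y)) j" for i j
      by (rule add[OF y], rule add[OF y1])
    show "h x 1 \<otimes>\<^bsub>G\<^esub> h (twist x k y) 1 = h (twist x 1 (twist x k y)) 1 \<otimes>\<^bsub>G\<^esub> h x 1"
      using adj_below[OF xy] by (intro rel) auto
  qed
  show ?thesis
  proof (induction a rule: int_induct[where k = 0])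
    case base
    have "h x 0 \<otimes>\<^bsub>G\<^esub> h x 0 = h x 0" using add[OF x, of 0 0] by simp
    then have "h x 0 = \<one>\<^bsub>G\<^esub>" using car[OF x] by (metis r_cancel_one')
    then show ?case
      using car[of y b] adj_vertsD[OF xy(1)] twist_0[OF x] by simp
  next
    case (step1 i)
    have "h x (1 + i) \<otimes>\<^bsub>G\<^esub> h y b = h x 1 \<otimes>\<^bsub>G\<^esub> (h (twist x i y) b \<otimes>\<^bsub>G\<^esub> h x i)"
      using step1 x y[of 0] twist_0[OF x] car by (simp add: add m_assoc)
    also have "\<dots> = (h (twist x (1 + i) y) b \<otimes>\<^bsub>G\<^esub> h x 1) \<otimes>\<^bsub>G\<^esub> h x i"
      using rel1[of i b] x y car by (simp add: m_assoc[symmetric] twist_add[OF x])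
    also have "\<dots> = h (twist x (1 + i) y) b \<otimes>\<^bsub>G\<^esub> h x (1 + i)"
      using x y car by (simp add: add[OF x] m_assoc)
    finally show ?case by (simp add: add.commute)
  next
    case (step2 i)
    have e: "twist x i y = twist x 1 (twist x (i - 1) y)" "h x i = h x 1 \<otimes>\<^bsub>G\<^esub> h x (i - 1)"
      using twist_add[OF x, of 1 "i - 1" y] add[OF x, of 1 "i - 1"] by simp_all
    show ?case
      by (rule intertwine_cancel_left[where c = "h x 1" and w = "h (twist x i y) b"])
        (use rel1[of "i - 1" b] step2 e x y twist_verts[OF x y] car adj_vertsD[OF xy(1)] in simp_all)
  qed
qed

lemma twist_Bij: "x \<in> verts \<Gamma> \<Longrightarrow> twist x k \<in> carrier (BijGroup UNIV)"
  using twist_inverse[of x k]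
  by (auto simp: BijGroup_def Bij_def intro!: bij_betw_byWitness[where f' = "twist x (- k)"])

lemma BijGroup_UNIV_mult:
  "f \<in> carrier (BijGroup UNIV) \<Longrightarrow> g \<in> carrier (BijGroup UNIV) \<Longrightarrow>
    f \<otimes>\<^bsub>BijGroup UNIV\<^esub> g = f \<circ> g"
  by (auto simp: BijGroup_def compose_def fun_eq_iff)

text \<open>The axiom \<open>aut_aut\<close> speaks of \<open>z < y < x\<close> only. If \<open>y < x\<close> but not \<open>z < y\<close>, then \<open>y\<close> fixes \<open>z\<close>, and
  \<open>\<phi>\<^sub>x(z)\<close> is not below \<open>\<phi>\<^sub>x(y)\<close>, so that \<open>\<phi>\<^sub>x(y)\<close> fixes it. If \<open>x\<close> and \<open>y\<close> are incomparable, the sets of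
  vertices that they move are disjoint, so the two permutations commute.\<close>

lemma twist_conj_1:
  assumes xy: "adj x y" "\<not> vless \<Gamma> x y"
  shows "twist x 1 (twist y 1 z) = twist (twist x 1 y) 1 (twist x 1 z)"
proof (cases "vless \<Gamma> y x")
  case True
  have x: "x \<in> verts \<Gamma>" and y: "y \<in> verts \<Gamma>" using xy adj_vertsD by auto
  let ?y' = "twist x 1 y"
  have y': "vless \<Gamma> ?y' x" "?y' \<in> verts \<Gamma>" using twist_below[OF x True] twist_verts[OF x y] .
  show ?thesis
  proof (cases "vless \<Gamma> z y")
    case z: True
    have zx: "vless \<Gamma> z x" using z True vless_trans by blast
    have "vless \<Gamma> (twist x 1 z) ?y'"
      using twist_vless_iff[OF x] vless_star[OF x] z zx True by blast
    moreover have "vless \<Gamma> (twist y 1 z) x"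
      using twist_below[OF y z] True vless_trans by blast
    ultimately show ?thesis
      using aut_aut[OF z True] z zx True y' x y by (simp add: twist_1 vless_star)
  next
    case z: False
    have "\<not> vless \<Gamma> (twist x 1 z) ?y'"
    proof
      assume a: "vless \<Gamma> (twist x 1 z) ?y'"
      then have "vless \<Gamma> z x" using y' vless_trans twist_below_iff[OF x] by blast
      then show False
        using a twist_vless_iff[OF x] vless_star[OF x] z True by blast
    qed
    then show ?thesis using z by (simp add: twist_fixes)
  qed
next
  case False
  have x: "x \<in> verts \<Gamma>" and y: "y \<in> verts \<Gamma>" using xy adj_vertsD by auto
  have y': "twist x 1 y = y" using False by (simp add: twist_fixes)
  note d = incomparable_down[OF xy False] incomparable_down[OF adj_sym[OF xy(1)] False xy(2)]
  show ?thesis unfolding y'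
    using d twist_below_iff[OF x] twist_below_iff[OF y] twist_fixes by metis
qed

text \<open>The central identity: the two sides of an operation of type II act as the same permutation of
  the vertices. The case \<open>x < y\<close> is the case \<open>y < x\<close> with the roles exchanged and \<open>b\<close> inverted.\<close>

lemma twist_exchange:
  assumes xy: "adj x y"
  shows "twist x a (twist y b z) = twist (twist x a y) b (twist (twist y (- b) x) a z)"
proof -
  have *: "twist x a (twist y b z) = twist (twist x a y) b (twist x a z)"
    if xy: "adj x y" "\<not> vless \<Gamma> x y" for x y a b z
  proof -
    have v: "x \<in> verts \<Gamma>" "y \<in> verts \<Gamma>" "twist x a y \<in> verts \<Gamma>" "\<And>x y. adj x y \<Longrightarrow> x \<in> verts \<Gamma>"
      "\<And>x y. adj x y \<Longrightarrow> y \<in> verts \<Gamma>" "\<And>x y. adj x y \<Longrightarrow> twist x 1 y \<in> verts \<Gamma>"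
      using xy adj_vertsD twist_verts by blast+
    have "twist x a \<otimes>\<^bsub>BijGroup UNIV\<^esub> twist y b = twist (twist x a y) b \<otimes>\<^bsub>BijGroup UNIV\<^esub> twist x a"
      by (rule exchange_powers[OF group_BijGroup _ _ _ xy])
        (auto simp: twist_Bij BijGroup_UNIV_mult v fun_eq_iff twist_add twist_conj_1)
    then show ?thesis
      using v by (simp add: BijGroup_UNIV_mult twist_Bij fun_eq_iff)
  qed
  have v: "x \<in> verts \<Gamma>" "y \<in> verts \<Gamma>" using xy adj_vertsD by auto
  show ?thesis
  proof (cases "vless \<Gamma> x y")
    case True
    then have "\<not> vless \<Gamma> y x" by (rule vless_asym)
    from *[OF adj_sym[OF xy] this, of "- b" a "twist y b z"]
    have "twist y b (twist y (- b) (twist x a (twist y b z))) =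
        twist y b (twist (twist y (- b) x) a z)"
      using v by (simp add: twist_inverse)
    then show ?thesis
      using v True by (simp add: twist_inverse twist_above)
  next
    case False
    then show ?thesis using *[OF xy] by (simp add: twist_fixes)
  qed
qed


section \<open>Exchanging adjacent syllables\<close>

type_synonym 'w syl = "'w \<times> int"

text \<open>An operation of type II replaces the syllables \<open>s, t\<close> by \<open>lmove s t, rmove s t\<close>: the first is
  \<open>t\<close> after it has moved to the left past \<open>s\<close>, and the second is \<open>s\<close> after it has moved to the
  right past \<open>t\<close>.\<close>

definition lmove :: "'v syl \<Rightarrow> 'v syl \<Rightarrow> 'v syl"
  where "lmove s t = (twist (fst s) (snd s) (fst t), snd t)"

definition rmove :: "'v syl \<Rightarrow> 'v syl \<Rightarrow> 'v syl"
  where "rmove s t = (twist (fst t) (- snd t) (fst s), snd s)"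

abbreviation sadj :: "'v syl \<Rightarrow> 'v syl \<Rightarrow> bool"
  where "sadj s t \<equiv> adj (fst s) (fst t)"

abbreviation stwist :: "'v syl \<Rightarrow> 'v \<Rightarrow> 'v"
  where "stwist s \<equiv> twist (fst s) (snd s)"

definition sinv :: "'v syl \<Rightarrow> 'v \<Rightarrow> 'v"
  where "sinv s = twist (fst s) (- snd s)"

lemma sadj_verts: "sadj s t \<Longrightarrow> fst s \<in> verts \<Gamma>" "sadj s t \<Longrightarrow> fst t \<in> verts \<Gamma>"
  using adj_vertsD by blast+

lemma sinv_stwist: "fst s \<in> verts \<Gamma> \<Longrightarrow> sinv s (stwist s z) = z"
  "fst s \<in> verts \<Gamma> \<Longrightarrow> stwist s (sinv s z) = z"
  by (simp_all add: sinv_def twist_inverse)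

lemma stwist_exchange:
  "sadj s t \<Longrightarrow> stwist s (stwist t z) = stwist (lmove s t) (stwist (rmove s t) z)"
  using twist_exchange by (simp add: lmove_def rmove_def)

text \<open>The new right syllable is determined by the new left one. Together with
  \<open>stwist_exchange\<close> this reduces the braid equation to computations with permutations.\<close>

lemma rmove_sinv:
  assumes "sadj s t"
  shows "rmove s t = (sinv (lmove s t) (fst s), snd s)"
  using twist_twisted_index[OF adj_sym[OF assms]] by (simp add: rmove_def sinv_def lmove_def)

lemma fst_rmove: "sadj s t \<Longrightarrow> fst (rmove s t) = sinv (lmove s t) (fst s)"
  by (simp add: rmove_sinv)

lemma sadj_move: "sadj s t \<Longrightarrow> sadj (lmove s t) (rmove s t)"
proof -
  assume st: "sadj s t"
  have "adj (stwist s (fst t)) (fst s)" "adj (fst t) (sinv t (fst s))"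
    using adj_sym[OF twist_adj[OF st]] twist_adj[OF adj_sym[OF st]] by (simp_all add: sinv_def)
  moreover have "fst s = sinv t (fst s) \<or> fst t = stwist s (fst t)"
    using vless_asym twist_fixes unfolding sinv_def by metis
  ultimately show ?thesis
    using adj_sym[OF st] unfolding lmove_def rmove_def sinv_def fst_conv by metis
qed

lemma move_involutive:
  assumes st: "sadj s t"
  shows "lmove (lmove s t) (rmove s t) = s" "rmove (lmove s t) (rmove s t) = t"
proof -
  have v: "fst s \<in> verts \<Gamma>" "fst t \<in> verts \<Gamma>" "fst (lmove s t) \<in> verts \<Gamma>" "fst (rmove s t) \<in> verts \<Gamma>"
    using sadj_verts st sadj_move[OF st] by auto
  show l: "lmove (lmove s t) (rmove s t) = s"
    using v sinv_stwist(2)[OF v(3)] by (simp add: rmove_sinv[OF st] lmove_def)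
  show "rmove (lmove s t) (rmove s t) = t"
    unfolding rmove_sinv[OF sadj_move[OF st]] l
    using v sinv_stwist(1)[OF v(1)] by (simp add: lmove_def)
qed

text \<open>If \<open>u\<close> can pass to the left of \<open>b\<close> and then of \<open>a\<close>, it can do so after \<open>a\<close> and \<open>b\<close> have been
  exchanged; this gives the first two adjacencies. The third one is that of the two syllables left
  behind by \<open>u\<close>. All of them hold because each twist is an automorphism of a star: a twist either
  applies to both vertices, or the vertex that it moves is below the other one and remains so.\<close>

lemma sadj_through:
  assumes "sadj a b" "sadj b u" "sadj a (lmove b u)"
  shows "sadj (rmove a b) u" "sadj (lmove a b) (lmove (rmove a b) u)"
    "sadj (rmove a (lmove b u)) (rmove b u)"
proof -
  obtain x k y l z m where e: "a = (x, k)" "b = (y, l)" "u = (z, m)" by (metis surj_pair)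
  let ?x1 = "twist y (- l) x" and ?y1 = "twist x k y" and ?z' = "twist y l z"
  have xy: "adj x y" and yz: "adj y z" and xz: "adj x ?z'"
    using assms by (simp_all add: e lmove_def)
  have v: "x \<in> verts \<Gamma>" "y \<in> verts \<Gamma>" "z \<in> verts \<Gamma>" using xy yz adj_vertsD by auto
  have "adj (twist y (- l) x) (twist y (- l) ?z')"
    using twist_adj_iff[OF v(2), of x ?z' "- l"] star_iff[OF v(2)] xy twist_adj[OF yz]
      adj_sym xz by blast
  then have x1z: "adj ?x1 z" using twist_inverse[OF v(2)] by simp
  then show "sadj (rmove a b) u" by (simp add: e rmove_def)
  have "adj ?y1 (twist ?x1 k z)"
  proof (cases "vless \<Gamma> x y")
    case True
    then have y1: "?y1 = y" by (simp add: twist_above)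
    have "vless \<Gamma> ?x1 y" using twist_below[OF v(2) True] .
    then have "adj y (twist ?x1 k z)"
      using twist_below[of ?x1 z k] twist_fixes[of z ?x1 k] adj_vertsD[OF x1z] vless_trans vless_adj
        adj_sym yz by metis
    then show ?thesis using y1 by simp
  next
    case False
    then have x1: "?x1 = x" by (simp add: twist_fixes)
    then show ?thesis
      using twist_adj_iff[OF v(1), of y z k] star_iff[OF v(1)] xy x1z yz by simp
  qed
  then show "sadj (lmove a b) (lmove (rmove a b) u)" by (simp add: e lmove_def rmove_def)
  have "adj (twist ?z' (- m) x) (twist z (- m) y)"
  proof (cases "vless \<Gamma> z y")
    case True
    then have y1: "twist z (- m) y = y" by (simp add: twist_above)
    have "vless \<Gamma> ?z' y" using twist_below[OF v(2) True] .
    then have "adj y (twist ?z' (- m) x)"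
      using twist_below[of ?z' x "-m"] twist_fixes[of x ?z' "-m"] adj_vertsD[OF xz] vless_trans vless_adj
        adj_sym xy by metis
    then show ?thesis using y1 adj_sym by metis
  next
    case False
    then have z1: "?z' = z" by (simp add: twist_fixes)
    then show ?thesis
      using twist_adj_iff[OF v(3), of x y "-m"] star_iff[OF v(3)] xy xz adj_sym[OF yz] adj_sym[OF xz]
      by simp
  qed
  then show "sadj (rmove a (lmove b u)) (rmove b u)" by (simp add: e lmove_def rmove_def)
qed

text \<open>Let \<open>f\<close> be the syllable that ends up in front when \<open>u\<close> passes \<open>b\<close> and \<open>a\<close>. That it is the same
  after \<open>a\<close> and \<open>b\<close> have been exchanged is \<open>stwist_exchange\<close> for \<open>a, b\<close>. In the middle, both sides
  then have the syllable obtained from \<open>lmove a b\<close> by undoing the twist of \<open>f\<close>. On the right, both have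
  the syllable obtained from \<open>a\<close> by undoing the twists of \<open>f\<close> and of the middle syllable.\<close>

lemma braid:
  assumes ab: "sadj a b" and bu: "sadj b u" and au: "sadj a (lmove b u)"
  shows "lmove (lmove a b) (lmove (rmove a b) u) = lmove a (lmove b u)"
    and "lmove (rmove a (lmove b u)) (rmove b u) = rmove (lmove a b) (lmove (rmove a b) u)"
    and "rmove (rmove a (lmove b u)) (rmove b u) = rmove (rmove a b) u"
proof -
  note adjs = sadj_through[OF assms]
  let ?f = "lmove a (lmove b u)"
  have fv: "fst ?f \<in> verts \<Gamma>" using sadj_verts(1)[OF sadj_move[OF au]] .
  show f: "lmove (lmove a b) (lmove (rmove a b) u) = ?f"
    using stwist_exchange[OF ab, of "fst u"] by (simp add: lmove_def)
  have "stwist (rmove a (lmove b u)) z = sinv ?f (stwist a (stwist (lmove b u) z))" for z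
    using stwist_exchange[OF au] sinv_stwist[OF fv] by simp
  moreover have "stwist (lmove b u) (fst (rmove b u)) = fst b"
    using move_involutive(1)[OF bu] by (metis lmove_def fst_conv)
  ultimately have m: "stwist (rmove a (lmove b u)) (fst (rmove b u)) = sinv ?f (stwist a (fst b))"
    by simp
  show mid: "lmove (rmove a (lmove b u)) (rmove b u) = rmove (lmove a b) (lmove (rmove a b) u)"
    using m unfolding rmove_sinv[OF adjs(2)] f by (simp add: lmove_def rmove_def)
  let ?m = "rmove (lmove a b) (lmove (rmove a b) u)"
  have v: "fst ?m \<in> verts \<Gamma>" "fst (lmove a b) \<in> verts \<Gamma>" "fst (lmove (rmove a b) u) \<in> verts \<Gamma>"
    using sadj_verts sadj_move adjs(2) by blast+
  have 1: "stwist (lmove a b) (stwist (lmove (rmove a b) u) z) = stwist ?f (stwist ?m z)" for z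
    using stwist_exchange[OF adjs(2)] f by simp
  have "sinv ?m (sinv ?f z) = sinv (lmove (rmove a b) u) (sinv (lmove a b) z)" for z
  proof -
    have "z = stwist ?f (stwist ?m (sinv (lmove (rmove a b) u) (sinv (lmove a b) z)))"
      using 1[of "sinv (lmove (rmove a b) u) (sinv (lmove a b) z)"] v sinv_stwist by simp
    then show ?thesis using v fv sinv_stwist by metis
  qed
  then have "fst (rmove (rmove a (lmove b u)) (rmove b u)) = fst (rmove (rmove a b) u)"
    using fst_rmove[OF adjs(3)] fst_rmove[OF adjs(1)] fst_rmove[OF au] fst_rmove[OF ab] mid
    by metis
  then show "rmove (rmove a (lmove b u)) (rmove b u) = rmove (rmove a b) u"
    by (simp add: rmove_def)
qed

text \<open>Two neighbouring syllables at the same vertex stay at a common vertex when both pass a third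
  syllable; hence merging them commutes with passing it.\<close>

lemma same_vertex_right:
  assumes "sadj p t" "fst t = fst t'"
  shows "sadj (rmove p t) t'" "fst (lmove (rmove p t) t') = fst (lmove p t)"
  using adj_sym[OF twist_adj[OF adj_sym[OF assms(1)], of "- snd t"]]
    twist_twisted_index[OF assms(1)] assms
  by (auto simp: rmove_def lmove_def)

lemma same_vertex_left:
  assumes "sadj t' u" "fst t = fst t'"
  shows "fst (rmove t (lmove t' u)) = fst (rmove t' u)"
  using twist_twisted_index[OF adj_sym[OF assms(1)]] assms by (simp add: rmove_def lmove_def)


section \<open>Words up to exchange\<close>

inductive swap :: "'v syl list \<Rightarrow> 'v syl list \<Rightarrow> bool"
  where
    here: "sadj s t \<Longrightarrow> swap (s # t # q) (lmove s t # rmove s t # q)"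
  | there: "swap w v \<Longrightarrow> swap (s # w) (s # v)"

abbreviation eqv :: "'v syl list \<Rightarrow> 'v syl list \<Rightarrow> bool"  (infix \<open>\<approx>\<close> 50)
  where "w \<approx> v \<equiv> swap\<^sup>*\<^sup>* w v"

lemma swap_sym: "swap w v \<Longrightarrow> swap v w"
proof (induction rule: swap.induct)
  case (here s t q)
  then show ?case
    using swap.here[OF sadj_move[OF here], of q] by (simp add: move_involutive)
qed (rule swap.there)

lemma eqv_sym: "w \<approx> v \<Longrightarrow> v \<approx> w"
  by (induction rule: rtranclp.induct) (auto intro: swap_sym converse_rtranclp_into_rtranclp)

lemma eqv_trans: "u \<approx> v \<Longrightarrow> v \<approx> w \<Longrightarrow> u \<approx> w"
  by (rule rtranclp_trans)

lemma eqv_Cons: "w \<approx> v \<Longrightarrow> s # w \<approx> s # v"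
  by (induction rule: rtranclp.induct) (auto intro: swap.there rtranclp.rtrancl_into_rtrancl)

lemma eqv_here: "sadj s t \<Longrightarrow> s # t # q \<approx> lmove s t # rmove s t # q"
  using swap.here by blast

lemma eqv_length: "w \<approx> v \<Longrightarrow> length w = length v"
proof (induction rule: rtranclp.induct)
  case (rtrancl_into_rtrancl a b c)
  have "length b = length c"
    using rtrancl_into_rtrancl(2) by (induction rule: swap.induct) auto
  then show ?case using rtrancl_into_rtrancl by simp
qed simp

text \<open>\<open>pull w s w'\<close> means that some syllable of \<open>w\<close> can be moved step by step to the front, where it
  arrives as \<open>s\<close>, leaving \<open>w'\<close> behind.\<close>

inductive pull :: "'v syl list \<Rightarrow> 'v syl \<Rightarrow> 'v syl list \<Rightarrow> bool"
  where
    first: "pull (s # w) s w"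
  | through: "pull w t w' \<Longrightarrow> sadj s t \<Longrightarrow> pull (s # w) (lmove s t) (rmove s t # w')"

lemma pull_ConsE [consumes 1, case_names first through]:
  assumes "pull (s # w) r w'"
  obtains "r = s" "w' = w"
    | t z where "r = lmove s t" "w' = rmove s t # z" "pull w t z" "sadj s t"
  using assms by (cases rule: pull.cases) auto

lemma pull_eqv: "pull w s w' \<Longrightarrow> w \<approx> s # w'"
proof (induction rule: pull.induct)
  case (through w t w' s)
  then show ?case using eqv_Cons[of w "t # w'" s] eqv_here eqv_trans by blast
qed simp

text \<open>The only case with content is an exchange of two syllables \<open>a, b\<close> that the pulled syllable \<open>u\<close>
  has to pass: by the braid equation it arrives at the front unchanged, and the syllables left
  behind differ by one exchange.\<close>

lemma pull_swap:
  "swap w v \<Longrightarrow> pull w s w' \<Longrightarrow> \<exists>v'. pull v s v' \<and> w' \<approx> v'"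
proof (induction arbitrary: s w' rule: swap.induct)
  case (here a b q)
  note inv = move_involutive[OF here(1)]
  from here(2) show ?case
  proof (cases rule: pull_ConsE)
    case first
    have "pull (lmove a b # rmove a b # q) (lmove (lmove a b) (rmove a b))
        (rmove (lmove a b) (rmove a b) # q)"
      by (intro pull.through pull.first sadj_move here)
    then show ?thesis using first inv by auto
  next
    case (through t w'')
    from through(3) show ?thesis
    proof (cases rule: pull_ConsE)
      case first
      then show ?thesis using through by (auto intro!: exI pull.first)
    next
      case bu: (through u q')
      have ab: "sadj a b" and bu': "sadj b u" and au: "sadj a (lmove b u)"
        using here(1) through(4) bu by auto
      note adjs = sadj_through[OF ab bu' au] and br = braid[OF ab bu' au]
      have "pull (lmove a b # rmove a b # q) (lmove (lmove a b) (lmove (rmove a b) u))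
          (rmove (lmove a b) (lmove (rmove a b) u) # rmove (rmove a b) u # q')"
        by (intro pull.through bu(3) adjs)
      moreover have "rmove a t # rmove b u # q' \<approx>
          rmove (lmove a b) (lmove (rmove a b) u) # rmove (rmove a b) u # q'"
        using eqv_here[OF adjs(3), of q'] br bu(1) by simp
      ultimately show ?thesis using through bu br(1) by auto
    qed
  qed
next
  case (there w v r)
  from there(3) show ?case
  proof (cases rule: pull_ConsE)
    case first
    then show ?thesis using there(1) pull.first by blast
  next
    case (through t w'')
    then obtain v' where "pull v t v'" "w'' \<approx> v'" using there(2) by blast
    then show ?thesis using through pull.through eqv_Cons by blast
  qed
qed

lemma pull_eqv_cong:
  "w \<approx> v \<Longrightarrow> pull w s w' \<Longrightarrow> \<exists>v'. pull v s v' \<and> w' \<approx> v'"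
proof (induction rule: rtranclp.induct)
  case (rtrancl_into_rtrancl a b c)
  then show ?case using pull_swap eqv_trans by meson
qed blast

lemma pull_of_eqv:
  assumes "w \<approx> s # w'"
  obtains w'' where "pull w s w''" "w'' \<approx> w'"
  using pull_eqv_cong[OF eqv_sym[OF assms] pull.first] eqv_sym by blast

text \<open>A syllable pulled past \<open>s\<close> ends at a vertex adjacent to that of \<open>s\<close>, hence at a different one.\<close>

lemma head_unique:
  assumes "s # w \<approx> t # w'" "fst s = fst t"
  shows "s = t \<and> w \<approx> w'"
proof -
  obtain w'' where w'': "pull (s # w) t w''" "w'' \<approx> w'"
    using pull_of_eqv[OF assms(1)] .
  from w''(1) show ?thesis
  proof (cases rule: pull_ConsE)
    case (through u z)
    then have "adj (fst s) (fst t)" using twist_adj by (simp add: lmove_def)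
    then show ?thesis using adj_vertsD assms(2) by blast
  qed (use w''(2) in simp)
qed

lemma head_exchange:
  assumes "s # w \<approx> t # w'" "fst s \<noteq> fst t"
  obtains u z where "sadj s u" "t = lmove s u" "w \<approx> u # z"
proof -
  obtain w'' where w'': "pull (s # w) t w''"
    using pull_of_eqv[OF assms(1)] .
  then show ?thesis
  proof (cases rule: pull_ConsE)
    case (through u z)
    then show ?thesis using that pull_eqv by blast
  qed (use assms(2) in simp)
qed


section \<open>Irreducible words\<close>

text \<open>Irreducibility: whenever two neighbouring syllables are at the same vertex, an operation of
  type I applies to them.\<close>

definition merge_free :: "'v syl list \<Rightarrow> bool"
  where "merge_free w \<longleftrightarrow> (\<forall>p s t q. w \<approx> p @ s # t # q \<longrightarrow> fst s \<noteq> fst t)"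

definition headfree :: "'v \<Rightarrow> 'v syl list \<Rightarrow> bool"
  where "headfree x w \<longleftrightarrow> (\<forall>b w'. \<not> w \<approx> (x, b) # w')"

lemma merge_free_eqv: "w \<approx> v \<Longrightarrow> merge_free w \<Longrightarrow> merge_free v"
  unfolding merge_free_def using eqv_trans by blast

lemma merge_free_Nil: "merge_free []"
  unfolding merge_free_def using eqv_length[of "[]"] by fastforce

lemma merge_free_tail: "merge_free (s # w) \<Longrightarrow> merge_free w"
  unfolding merge_free_def using eqv_Cons[of w _ s] append_Cons[of s] by metis

lemma headfree_eqv: "w \<approx> v \<Longrightarrow> headfree x w \<Longrightarrow> headfree x v"
  unfolding headfree_def using eqv_trans by blast

lemma headfree_tail: "merge_free ((x, b) # w) \<Longrightarrow> headfree x w"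
  unfolding headfree_def
proof (intro allI notI)
  fix c w' assume "merge_free ((x, b) # w)" "w \<approx> (x, c) # w'"
  then have "(x, b) # w \<approx> [] @ (x, b) # (x, c) # w'" using eqv_Cons by simp
  with \<open>merge_free ((x, b) # w)\<close> have "fst (x, b) \<noteq> fst (x, c)" unfolding merge_free_def by blast
  then show False by simp
qed

text \<open>What happens to two neighbouring syllables \<open>t, t'\<close> at one vertex when a syllable \<open>s\<close> is pulled to
  the front. If \<open>s\<close> comes from elsewhere, a pair at a common vertex remains; if it comes from \<open>t\<close>, then
  \<open>t'\<close> can follow on the same way and arrives at the vertex of \<open>s\<close>. It cannot come from \<open>t'\<close>, as \<open>t'\<close>
  cannot pass \<open>t\<close>.\<close>

lemma pull_pair:
  assumes "pull (p @ t # t' # q) s w" "fst t = fst t'"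
  shows "(\<exists>p' r r' q'. w = p' @ r # r' # q' \<and> fst r = fst r') \<or>
    (\<exists>s' w'. pull w s' w' \<and> fst s = fst s')"
  using assms(1)
proof (induction p arbitrary: s w)
  case Nil
  then have "pull (t # t' # q) s w" by simp
  then show ?case
  proof (cases rule: pull_ConsE)
    case first
    then show ?thesis using assms(2) pull.first by metis
  next
    case (through k w1)
    from through(3) show ?thesis
    proof (cases rule: pull_ConsE)
      case first
      then show ?thesis using through(4) assms(2) adj_vertsD by metis
    next
      case u: (through u w2)
      have "fst (rmove t k) = fst (rmove t' u)"
        using same_vertex_left[OF u(4) assms(2)] u(1) by simp
      then show ?thesis
        using through(2) u(2) append_Nil by metis
    qed
  qed
next
  case (Cons g p)
  then have "pull (g # p @ t # t' # q) s w" by simp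
  then show ?case
  proof (cases rule: pull_ConsE)
    case first
    then show ?thesis using assms(2) by blast
  next
    case (through k w1)
    from Cons.IH[OF through(3)] show ?thesis
    proof
      assume "\<exists>p' r r' q'. w1 = p' @ r # r' # q' \<and> fst r = fst r'"
      then show ?thesis using through(2) append_Cons by metis
    next
      assume "\<exists>s' w'. pull w1 s' w' \<and> fst k = fst s'"
      then obtain k' w' where k': "pull w1 k' w'" "fst k = fst k'" by blast
      note sv = same_vertex_right[OF through(4) k'(2)]
      have "pull w (lmove (rmove g k) k') (rmove (rmove g k) k' # w')"
        using pull.through[OF k'(1) sv(1)] through(2) by simp
      then show ?thesis using sv(2) through(1) by metis
    qed
  qed
qed

lemma merge_free_Cons:
  assumes "merge_free w" "headfree x w"
  shows "merge_free ((x, a) # w)"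
  unfolding merge_free_def
proof (intro allI impI notI)
  fix p t t' q
  assume e: "(x, a) # w \<approx> p @ t # t' # q" and same: "fst t = fst t'"
  obtain w'' where w'': "pull (p @ t # t' # q) (x, a) w''" "w'' \<approx> w"
    using pull_of_eqv[OF eqv_sym[OF e]] .
  from pull_pair[OF w''(1) same] show False
  proof
    assume "\<exists>p' r r' q'. w'' = p' @ r # r' # q' \<and> fst r = fst r'"
    then show False using assms(1) eqv_sym[OF w''(2)] unfolding merge_free_def by blast
  next
    assume "\<exists>s' w'. pull w'' s' w' \<and> fst (x, a) = fst s'"
    then obtain b w' where "pull w'' (x, b) w'" by auto
    then show False
      using assms(2) w''(2) eqv_sym eqv_trans pull_eqv unfolding headfree_def by blast
  qed
qed


section \<open>The action on irreducible words\<close>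

text \<open>The modulus of the exponents at \<open>x\<close>. The value 0 for infinite labels fits the convention
  \<open>k mod 0 = k\<close>.\<close>

definition exp_period :: "'v \<Rightarrow> int"
  where "exp_period x = (case vlabel \<Gamma> x of enat n \<Rightarrow> int n | \<infinity> \<Rightarrow> 0)"

lemma exp_period_twist: "x \<in> verts \<Gamma> \<Longrightarrow> exp_period (twist x k y) = exp_period y"
  by (simp add: exp_period_def twist_label)

lemma exp_group_period: "exp_group \<Gamma> x = integer_mod_group (nat (exp_period x))"
  by (auto simp: exp_group_def exp_period_def integer_mod_group_def split: enat.split)

lemma exp_period_nonneg: "0 \<le> exp_period x"
  by (auto simp: exp_period_def split: enat.split)

lemma syllables_iff: "(x, a) \<in> syllables \<Gamma> \<longleftrightarrow> x \<in> verts \<Gamma> \<and> a mod exp_period x = a \<and> a \<noteq> 0"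
proof -
  have "a \<in> carrier (exp_group \<Gamma> x) \<longleftrightarrow> a mod exp_period x = a"
    using exp_period_nonneg[of x] pos_mod_sign[of "exp_period x" a] pos_mod_bound[of "exp_period x" a]
    by (auto simp: exp_group_period carrier_integer_mod_group simp del: pos_mod_sign pos_mod_bound)
  then show ?thesis by (auto simp: syllables_def exp_group_period)
qed

lemma twist_mod_period:
  assumes x: "x \<in> verts \<Gamma>"
  shows "twist x (k mod exp_period x) = twist x k"
proof (cases "vlabel \<Gamma> x")
  case (enat n)
  interpret B: group "BijGroup (star \<Gamma> x)" by (rule group_BijGroup)
  have "vaut \<Gamma> x \<in> carrier (BijGroup (star \<Gamma> x))"
    using aut[OF x] by (simp add: star_auts_def)
  moreover have "int (B.ord (vaut \<Gamma> x)) dvd k - k mod int n"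
    using aut_order[OF x enat] by (meson dvd_minus_mod dvd_trans int_dvd_int_iff)
  ultimately have "vaut_pow \<Gamma> x (k mod exp_period x) = vaut_pow \<Gamma> x k"
    unfolding vaut_pow_def by (simp add: B.int_pow_eq exp_period_def enat)
  then show ?thesis by (simp add: twist_def fun_eq_iff)
qed (simp add: exp_period_def)

lemma swap_syllabic: "swap w v \<Longrightarrow> w \<in> syllabic_words \<Gamma> \<Longrightarrow> v \<in> syllabic_words \<Gamma>"
proof (induction rule: swap.induct)
  case (here s t q)
  then show ?case
    using adj_vertsD[OF here(1)] syllables_iff[of "fst s" "snd s"] syllables_iff[of "fst t" "snd t"]
    by (simp add: syllabic_words_def syllables_iff lmove_def rmove_def exp_period_twist twist_verts)
qed (auto simp: syllabic_words_def)

lemma eqv_syllabic: "w \<approx> v \<Longrightarrow> w \<in> syllabic_words \<Gamma> \<Longrightarrow> v \<in> syllabic_words \<Gamma>"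
  by (induction rule: rtranclp.induct) (auto intro: swap_syllabic)

definition irreducible_words :: "'v syl list set"
  where "irreducible_words = {w \<in> syllabic_words \<Gamma>. merge_free w}"

lemma irreducible_words_eqv: "w \<approx> v \<Longrightarrow> w \<in> irreducible_words \<Longrightarrow> v \<in> irreducible_words"
  unfolding irreducible_words_def using eqv_syllabic merge_free_eqv by blast

lemma irreducible_words_Nil: "[] \<in> irreducible_words"
  by (simp add: irreducible_words_def syllabic_words_def merge_free_Nil)

text \<open>The word \<open>x\<^sup>k w\<close> for an arbitrary integer \<open>k\<close>, the exponent being reduced, and dropped if it
  vanishes.\<close>

definition push :: "'v \<Rightarrow> int \<Rightarrow> 'v syl list \<Rightarrow> 'v syl list"
  where "push x k w = (if k mod exp_period x = 0 then w else (x, k mod exp_period x) # w)"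

lemma push_mod: "k mod exp_period x = l mod exp_period x \<Longrightarrow> push x k w = push x l w"
  by (simp add: push_def)

lemma push_eqv: "w \<approx> v \<Longrightarrow> push x k w \<approx> push x k v"
  by (simp add: push_def eqv_Cons)

lemma push_irreducible_words:
  assumes "x \<in> verts \<Gamma>" "w \<in> irreducible_words" "headfree x w"
  shows "push x k w \<in> irreducible_words"
  using assms merge_free_Cons by (auto simp: irreducible_words_def push_def syllabic_words_def syllables_iff)

text \<open>Existence and uniqueness of the splitting \<open>x\<^sup>b w'\<close> in which \<open>w'\<close> has no leading syllable at \<open>x\<close>;
  \<open>b = 0\<close> if \<open>w\<close> has none.\<close>

lemma decompose:
  assumes "w \<in> irreducible_words"
  obtains b w' where "w \<approx> push x b w'" "headfree x w'" "w' \<in> irreducible_words"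
proof (cases "headfree x w")
  case True
  then show ?thesis using that[of 0 w] assms by (simp add: push_def)
next
  case False
  then obtain b w' where w: "w \<approx> (x, b) # w'" by (auto simp: headfree_def)
  have g: "(x, b) # w' \<in> irreducible_words" using irreducible_words_eqv[OF w assms] .
  then have "push x b w' = (x, b) # w'"
    by (simp add: irreducible_words_def syllabic_words_def syllables_iff push_def)
  moreover have "w' \<in> irreducible_words" using g merge_free_tail by (auto simp: irreducible_words_def syllabic_words_def)
  moreover have "headfree x w'" using g headfree_tail by (auto simp: irreducible_words_def)
  ultimately show ?thesis using that w by metis
qed

lemma decompose_unique:
  assumes e: "push x b w \<approx> push x c v" and h: "headfree x w" "headfree x v"
  shows "b mod exp_period x = c mod exp_period x \<and> w \<approx> v"
proof -
  consider "b mod exp_period x = 0" "c mod exp_period x = 0" | "b mod exp_period x = 0" "c mod exp_period x \<noteq> 0"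
    | "b mod exp_period x \<noteq> 0" "c mod exp_period x = 0" | "b mod exp_period x \<noteq> 0" "c mod exp_period x \<noteq> 0" by blast
  then show ?thesis
  proof cases
    case 1
    then show ?thesis using e by (simp add: push_def)
  next
    case 2
    then show ?thesis using e h(1) by (simp add: push_def headfree_def)
  next
    case 3
    then show ?thesis using eqv_sym[OF e] h(2) by (simp add: push_def headfree_def)
  next
    case 4
    then show ?thesis using head_unique[of "(x, b mod exp_period x)" w "(x, c mod exp_period x)" v] e
      by (simp add: push_def)
  qed
qed

text \<open>The action of \<open>x\<^sup>k\<close>. By \<open>decompose_unique\<close> the choice does not matter up to equivalence.\<close>

definition act :: "'v \<Rightarrow> int \<Rightarrow> 'v syl list \<Rightarrow> 'v syl list"
  where "act x k w =
    (let (b, w') = SOME (b, w'). w \<approx> push x b w' \<and> headfree x w' in push x (k + b) w')"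

lemma act_decomposed:
  assumes w: "w \<approx> push x b w'" and h: "headfree x w'"
  shows "act x k w \<approx> push x (k + b) w'"
proof -
  obtain c v where cv: "(SOME (b, w'). w \<approx> push x b w' \<and> headfree x w') = (c, v)"
    by (rule prod.exhaust)
  have "\<exists>p. case p of (b, w') \<Rightarrow> w \<approx> push x b w' \<and> headfree x w'"
    using assms by auto
  then have "case (c, v) of (b, w') \<Rightarrow> w \<approx> push x b w' \<and> headfree x w'"
    unfolding cv[symmetric] by (rule someI_ex)
  then have v: "w \<approx> push x c v" "headfree x v" by auto
  have "push x b w' \<approx> push x c v" using eqv_trans[OF eqv_sym[OF w] v(1)] .
  from decompose_unique[OF this h v(2)]
  have "b mod exp_period x = c mod exp_period x" "v \<approx> w'" using eqv_sym by auto
  moreover from this(1) have "push x (k + b) w' = push x (k + c) w'"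
    by (intro push_mod) (metis mod_add_right_eq)
  ultimately show ?thesis using push_eqv[of v w' x "k + c"] by (simp add: act_def cv)
qed

lemma act_eqv:
  assumes "w \<in> irreducible_words" and wv: "w \<approx> v"
  shows "act x k w \<approx> act x k v"
proof -
  obtain b w' where w: "w \<approx> push x b w'" "headfree x w'" using decompose[OF assms(1)] .
  have "v \<approx> push x b w'" using eqv_trans[OF eqv_sym[OF wv] w(1)] .
  from act_decomposed[OF this w(2), of k] show ?thesis
    using act_decomposed[OF w, of k] eqv_sym eqv_trans by blast
qed

lemma act_irreducible_words:
  assumes "x \<in> verts \<Gamma>" "w \<in> irreducible_words"
  shows "act x k w \<in> irreducible_words"
proof -
  obtain b w' where w: "w \<approx> push x b w'" "headfree x w'" "w' \<in> irreducible_words"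
    using decompose[OF assms(2)] .
  show ?thesis
    using irreducible_words_eqv[OF eqv_sym[OF act_decomposed[OF w(1,2)]] push_irreducible_words[OF assms(1) w(3,2)]] .
qed

lemma act_add:
  assumes "w \<in> irreducible_words"
  shows "act x k (act x l w) \<approx> act x (k + l) w"
proof -
  obtain b w' where w: "w \<approx> push x b w'" "headfree x w'" using decompose[OF assms] .
  have "act x k (act x l w) \<approx> push x (k + (l + b)) w'"
    by (rule act_decomposed[OF act_decomposed[OF w] w(2)])
  then show ?thesis
    using eqv_trans[OF _ eqv_sym[OF act_decomposed[OF w, of "k + l"]]] by (simp only: add.assoc)
qed

lemma act_multiple:
  assumes "w \<in> irreducible_words" "k mod exp_period x = 0"
  shows "act x k w \<approx> w"
proof -
  obtain b w' where w: "w \<approx> push x b w'" "headfree x w'" using decompose[OF assms(1)] .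
  have "push x (k + b) w' = push x b w'"
    using assms(2) by (intro push_mod) (metis add_0 mod_add_left_eq)
  then show ?thesis using eqv_trans[OF act_decomposed[OF w, of k]] eqv_sym[OF w(1)] by simp
qed

lemma act_Cons:
  assumes "(x, a) # w \<in> irreducible_words"
  shows "act x a w \<approx> (x, a) # w"
proof -
  have "a mod exp_period x = a" "a \<noteq> 0" "merge_free ((x, a) # w)"
    using assms by (auto simp: irreducible_words_def syllabic_words_def syllables_iff)
  then show ?thesis
    using act_decomposed[of w x 0 w a] headfree_tail by (simp add: push_def)
qed

text \<open>Passing \<open>x\<^sup>a\<close> turns leading syllables at \<open>y\<close> into leading syllables at \<open>\<phi>\<^sub>x\<^sup>a(y)\<close>, and all leading
  syllables at that vertex arise in this way, by \<open>head_exchange\<close>.\<close>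

lemma headfree_push:
  assumes xy: "adj x y"
  shows "headfree (twist x a y) (push x a w) \<longleftrightarrow> headfree y w"
proof -
  have x: "x \<in> verts \<Gamma>" using xy adj_vertsD by blast
  note tp = twist_mod_period[OF x, of a]
  show ?thesis
  proof (cases "a mod exp_period x = 0")
    case True
    then have "twist x a y = y" using tp twist_0[OF x] by simp
    then show ?thesis using True by (simp add: push_def)
  next
    case False
    define s where "s = (x, a mod exp_period x)"
    have w: "push x a w = s # w" using False by (simp add: push_def s_def)
    have lm: "lmove s (z, b) = (twist x a z, b)" for z b by (simp add: lmove_def s_def tp)
    have "s # w \<approx> (twist x a y, b) # v \<Longrightarrow> \<exists>v'. w \<approx> (y, b) # v'" for b v
    proof -
      assume e: "s # w \<approx> (twist x a y, b) # v"
      have "fst s \<noteq> fst (twist x a y, b)" using twist_adj[OF xy] adj_vertsD by (simp add: s_def)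
      from head_exchange[OF e this] obtain u z
        where u: "(twist x a y, b) = lmove s u" "w \<approx> u # z" .
      have "u = (y, b)"
        using u(1) lm[of "fst u" "snd u"] twist_inverse(1)[OF x] by (metis Pair_inject prod.collapse)
      then show ?thesis using u(2) by blast
    qed
    moreover have "s # w \<approx> (twist x a y, b) # rmove s (y, b) # v" if "w \<approx> (y, b) # v" for b v
    proof -
      have "sadj s (y, b)" using xy by (simp add: s_def)
      from eqv_here[OF this, of v] show ?thesis
        using eqv_trans[OF eqv_Cons[OF that, of s]] lm by simp
    qed
    ultimately show ?thesis unfolding w headfree_def by blast
  qed
qed

lemma push_exchange:
  assumes xy: "adj x y" "\<not> vless \<Gamma> x y"
  shows "push x a (push y b w) \<approx> push (twist x a y) b (push x a w)"
proof -
  have x: "x \<in> verts \<Gamma>" using xy adj_vertsD by blast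
  note tp = twist_mod_period[OF x, of a]
  have ta: "twist x a y = y" if "a mod exp_period x = 0" using tp twist_0[OF x] that by simp
  have "sadj (x, a mod exp_period x) (y, b mod exp_period y)" using xy by simp
  from eqv_here[OF this, of w] show ?thesis
    using ta by (auto simp: push_def exp_period_twist[OF x] lmove_def rmove_def tp twist_fixes xy(2))
qed

text \<open>Split \<open>w\<close> as \<open>y\<^sup>d x\<^sup>c u\<close>, which is also \<open>x\<^sup>c z\<^sup>d u\<close> with \<open>z = \<phi>\<^sub>x\<^sup>-\<^sup>c(y)\<close>, so that \<open>u\<close> has no leading
  syllable at \<open>x\<close> or \<open>z\<close>. By \<open>headfree_push\<close> each of these forms is the splitting that defines the
  action of its first vertex, and both sides of the relation turn out to be \<open>x\<^sup>a\<^sup>+\<^sup>c z\<^sup>b\<^sup>+\<^sup>d u\<close>.\<close>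

lemma act_exchange:
  assumes xy: "adj x y" "\<not> vless \<Gamma> x y" and w: "w \<in> irreducible_words"
  shows "act x a (act y b w) \<approx> act (twist x a y) b (act x a w)"
proof -
  have x: "x \<in> verts \<Gamma>" using xy adj_vertsD by blast
  obtain d v where dv: "w \<approx> push y d v" "headfree y v" "v \<in> irreducible_words" using decompose[OF w] .
  obtain c u where cu: "v \<approx> push x c u" "headfree x u" using decompose[OF dv(3)] .
  define z where "z = twist x (- c) y"
  have zy: "twist x c z = y" using twist_inverse[OF x] by (simp add: z_def)
  have xz: "adj x z" "\<not> vless \<Gamma> x z" using adj_below[OF xy] by (auto simp: z_def)
  have hz: "headfree z u"
    using headfree_push[OF xz(1), of c u] headfree_eqv[OF cu(1) dv(2)] zy by simp
  have hx: "headfree x (push z e u)" for e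
    using headfree_push[OF adj_sym[OF xz(1)], of e u] cu(2) twist_fixes[OF xz(2)] by simp
  have move: "push y e v \<approx> push x c (push z e u)" for e
    using eqv_trans[OF push_eqv[OF cu(1), of y e]] eqv_sym[OF push_exchange[OF xz, of c e u]] zy
    by simp
  have tz: "twist x (a + c) z = twist x a y" using twist_add[OF x] zy by simp
  note ex = push_exchange[OF xz, of "a + c", unfolded tz]
  have "act y b w \<approx> push x c (push z (b + d) u)"
    by (rule eqv_trans[OF act_decomposed[OF dv(1,2)] move])
  from act_decomposed[OF this hx]
  have left: "act x a (act y b w) \<approx> push x (a + c) (push z (b + d) u)" .
  have "w \<approx> push x c (push z d u)" by (rule eqv_trans[OF dv(1) move])
  from act_decomposed[OF this hx]
  have "act x a w \<approx> push (twist x a y) d (push x (a + c) u)"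
    by (rule eqv_trans[OF _ ex])
  moreover have "headfree (twist x a y) (push x (a + c) u)"
    using headfree_push[OF xz(1), of "a + c" u] hz tz by simp
  ultimately have "act (twist x a y) b (act x a w) \<approx>
      push (twist x a y) (b + d) (push x (a + c) u)"
    by (rule act_decomposed)
  from eqv_trans[OF left eqv_trans[OF ex eqv_sym[OF this]]] show ?thesis .
qed

section \<open>The action of the trickle group\<close>

lemma vaut_twist: "adj x y \<Longrightarrow> vaut \<Gamma> x y = twist x 1 y"
  using twist_1 star_iff adj_vertsD by blast

definition letter_act :: "'v \<times> bool \<Rightarrow> 'v syl list \<Rightarrow> 'v syl list"
  where "letter_act l = act (fst l) (if snd l then 1 else - 1)"

definition gword_act :: "'v gword \<Rightarrow> 'v syl list \<Rightarrow> 'v syl list"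
  where "gword_act = foldr letter_act"

lemma gword_act_simps [simp]:
  "gword_act [] w = w" "gword_act (l # u) w = letter_act l (gword_act u w)"
  "gword_act (u @ v) w = gword_act u (gword_act v w)"
  by (simp_all add: gword_act_def)

lemma gword_act_irreducible_words: "u \<in> gwords (verts \<Gamma>) \<Longrightarrow> w \<in> irreducible_words \<Longrightarrow> gword_act u w \<in> irreducible_words"
  by (induction u) (auto simp: gwords_def letter_act_def intro: act_irreducible_words)

lemma gword_act_eqv:
  "u \<in> gwords (verts \<Gamma>) \<Longrightarrow> w \<in> irreducible_words \<Longrightarrow> w \<approx> v \<Longrightarrow> gword_act u w \<approx> gword_act u v"
proof (induction u)
  case (Cons l u)
  then have "u \<in> gwords (verts \<Gamma>)" by (simp add: gwords_def)
  then show ?case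
    using act_eqv[OF gword_act_irreducible_words] Cons by (simp add: letter_act_def)
qed simp

lemma gword_act_replicate:
  assumes x: "x \<in> verts \<Gamma>" and w: "w \<in> irreducible_words"
  shows "gword_act (replicate n (x, e)) w \<approx> act x (if e then int n else - int n) w"
proof (induction n)
  case 0
  then show ?case using eqv_sym[OF act_multiple[OF w, of 0 x]] by simp
next
  case (Suc n)
  let ?s = "if e then 1 else - 1 :: int" and ?k = "if e then int n else - int n"
  have "replicate n (x, e) \<in> gwords (verts \<Gamma>)" using x by (auto simp: gwords_def)
  then have g: "gword_act (replicate n (x, e)) w \<in> irreducible_words" using w by (rule gword_act_irreducible_words)
  have "gword_act (replicate (Suc n) (x, e)) w \<approx> act x ?s (act x ?k w)"
    using act_eqv[OF g Suc] by (simp add: letter_act_def)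
  from eqv_trans[OF this act_add[OF w]]
  have "gword_act (replicate (Suc n) (x, e)) w \<approx> act x (?s + ?k) w" .
  moreover have "?s + ?k = (if e then int (Suc n) else - int (Suc n))" by simp
  ultimately show ?case by (simp only:)
qed

lemma gword_act_exchange_relation:
  assumes xy: "{x, y} \<in> edges \<Gamma>" and w: "w \<in> irreducible_words"
  shows "gword_act [(vaut \<Gamma> x y, True), (x, True)] w \<approx> gword_act [(vaut \<Gamma> y x, True), (y, True)] w"
proof -
  have adjs: "adj x y" "adj y x" using xy by (simp_all add: adj_def insert_commute)
  have *: "act (twist x 1 y) 1 (act x 1 w) \<approx> act (twist y 1 x) 1 (act y 1 w)"
    if "adj x y" "\<not> vless \<Gamma> x y" for x y
    using eqv_sym[OF act_exchange[OF that w, of 1 1]] that by (simp add: twist_fixes)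
  show ?thesis
    using *[OF adjs(1)] eqv_sym[OF *[OF adjs(2)]] vless_asym adjs
    by (auto simp: letter_act_def vaut_twist simp del: gword_act_simps(3))
qed

text \<open>The action respects the presentation. The group itself never has to act: induction over the
  congruence on group words suffices.\<close>

lemma gword_act_pres_rel:
  "(u, v) \<in> pres_rel (verts \<Gamma>) (trickle_relations \<Gamma>) \<Longrightarrow> w \<in> irreducible_words \<Longrightarrow>
    gword_act u w \<approx> gword_act v w"
proof (induction arbitrary: w rule: pres_rel.induct)
  case (sym u v)
  then show ?case using eqv_sym by blast
next
  case (trans u v z)
  then show ?case using eqv_trans by blast
next
  case (append u u' v v')
  have m: "u \<in> gwords (verts \<Gamma>)" "v \<in> gwords (verts \<Gamma>)" "v' \<in> gwords (verts \<Gamma>)"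
    using append(1,2) pres_rel_gwords by blast+
  have "gword_act u (gword_act v w) \<approx> gword_act u (gword_act v' w)"
    using gword_act_eqv[OF m(1) gword_act_irreducible_words[OF m(2) append(5)]] append(4)[OF append(5)] .
  from eqv_trans[OF this append(3)[OF gword_act_irreducible_words[OF m(3) append(5)]]] show ?case by simp
next
  case (cancel x e)
  define s :: int where "s = (if e then 1 else - 1)"
  have "(if \<not> e then 1 else - 1) = - s" by (simp add: s_def)
  then have "gword_act [(x, e), (x, \<not> e)] w = act x s (act x (- s) w)"
    by (simp add: letter_act_def s_def)
  then show ?case
    using eqv_trans[OF act_add[OF cancel(2), of x s "- s"]] act_multiple[OF cancel(2), of 0 x] by simp
next
  case (relation u v)
  from relation(1) show ?case unfolding trickle_relations_def
  proof
    assume "(u, v) \<in> {(replicate n (x, True), []) |x n. x \<in> verts \<Gamma> \<and> vlabel \<Gamma> x = enat n}"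
    then obtain x n where u: "u = replicate n (x, True)" "v = []"
      and x: "x \<in> verts \<Gamma>" "vlabel \<Gamma> x = enat n" by blast
    have "act x (int n) w \<approx> w"
      using x(2) by (intro act_multiple[OF relation(4)]) (simp add: exp_period_def)
    then show ?thesis
      using eqv_trans[OF gword_act_replicate[OF x(1) relation(4), of n True]] unfolding u by simp
  next
    assume "(u, v) \<in> {([(vaut \<Gamma> x y, True), (x, True)], [(vaut \<Gamma> y x, True), (y, True)]) |x y.
        {x, y} \<in> edges \<Gamma>}"
    then show ?thesis using gword_act_exchange_relation relation(4) by blast
  qed
qed simp

definition syl_gword :: "'v syl \<Rightarrow> 'v gword"
  where "syl_gword s = replicate (nat \<bar>snd s\<bar>) (fst s, 0 \<le> snd s)"

definition word_gword :: "'v syl list \<Rightarrow> 'v gword"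
  where "word_gword w = concat (map syl_gword w)"

lemma word_gword_simps [simp]:
  "word_gword [] = []" "word_gword (s # w) = syl_gword s @ word_gword w"
  by (simp_all add: word_gword_def)

lemma syl_gword_gwords: "fst s \<in> verts \<Gamma> \<Longrightarrow> syl_gword s \<in> gwords (verts \<Gamma>)"
  by (auto simp: syl_gword_def gwords_def)

lemma syllabic_Cons:
  "s # w \<in> syllabic_words \<Gamma> \<Longrightarrow> fst s \<in> verts \<Gamma> \<and> w \<in> syllabic_words \<Gamma>"
  using syllables_iff[of "fst s" "snd s"] by (simp add: syllabic_words_def)

lemma word_gword_gwords: "w \<in> syllabic_words \<Gamma> \<Longrightarrow> word_gword w \<in> gwords (verts \<Gamma>)"
proof (induction w)
  case (Cons s w)
  then have "syl_gword s \<in> gwords (verts \<Gamma>)" "word_gword w \<in> gwords (verts \<Gamma>)"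
    using syllabic_Cons[of s w] syl_gword_gwords by auto
  then show ?case by (simp add: gwords_def)
qed (simp add: gwords_def)

text \<open>Every final part of an irreducible word is irreducible and has no leading syllable at the vertex
  before it, so building up the word from the empty one never merges anything.\<close>

lemma gword_act_word: "w \<in> irreducible_words \<Longrightarrow> gword_act (word_gword w) [] \<approx> w"
proof (induction w)
  case (Cons s w)
  then have x: "fst s \<in> verts \<Gamma>" and w: "w \<in> irreducible_words"
    using syllabic_Cons[of s w] merge_free_tail[of s w] by (auto simp: irreducible_words_def)
  have "word_gword w \<in> gwords (verts \<Gamma>)" using w word_gword_gwords by (simp add: irreducible_words_def)
  then have g: "gword_act (word_gword w) [] \<in> irreducible_words" using gword_act_irreducible_words irreducible_words_Nil by blast
  have "gword_act (syl_gword s) (gword_act (word_gword w) []) \<approx> gword_act (syl_gword s) w"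
    by (rule gword_act_eqv[OF syl_gword_gwords[OF x] g Cons.IH[OF w]])
  also have "gword_act (syl_gword s) w \<approx> act (fst s) (snd s) w"
    using gword_act_replicate[OF x w, of "nat \<bar>snd s\<bar>" "0 \<le> snd s"]
    by (simp add: syl_gword_def split: if_splits)
  also have "act (fst s) (snd s) w \<approx> s # w"
    using act_Cons[of "fst s" "snd s" w] Cons.prems by simp
  finally show ?case by simp
qed simp


section \<open>Evaluation in the trickle group\<close>

abbreviation Tr :: "'v gword set monoid"
  where "Tr \<equiv> trickle_group \<Gamma>"

definition gclass :: "'v gword \<Rightarrow> 'v gword set"
  where "gclass u = pres_rel (verts \<Gamma>) (trickle_relations \<Gamma>) `` {u}"

lemma group_Tr: "group Tr"
  by (simp add: trickle_group_def group_presented_group)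

lemma gclass_mult:
  "u \<in> gwords (verts \<Gamma>) \<Longrightarrow> v \<in> gwords (verts \<Gamma>) \<Longrightarrow> gclass u \<otimes>\<^bsub>Tr\<^esub> gclass v = gclass (u @ v)"
  unfolding trickle_group_def gclass_def by (rule mult_pres_class)

lemma gclass_one: "\<one>\<^bsub>Tr\<^esub> = gclass []"
  by (simp add: trickle_group_def presented_group_def gclass_def)

lemma gclass_carrier: "u \<in> gwords (verts \<Gamma>) \<Longrightarrow> gclass u \<in> carrier Tr"
  by (simp add: trickle_group_def presented_group_def gclass_def quotientI)

lemma gclass_eqI: "(u, v) \<in> pres_rel (verts \<Gamma>) (trickle_relations \<Gamma>) \<Longrightarrow> gclass u = gclass v"
  unfolding gclass_def by (rule equiv_class_eq[OF equiv_pres_rel])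

lemma gclass_eqD:
  "gclass u = gclass v \<Longrightarrow> v \<in> gwords (verts \<Gamma>) \<Longrightarrow>
    (u, v) \<in> pres_rel (verts \<Gamma>) (trickle_relations \<Gamma>)"
  unfolding gclass_def by (rule eq_equiv_class[OF _ equiv_pres_rel])

lemma gen_gclass: "trickle_gen \<Gamma> x = gclass [(x, True)]"
  by (simp add: trickle_gen_def pres_gen_def gclass_def)

lemma gen_carrier: "x \<in> verts \<Gamma> \<Longrightarrow> trickle_gen \<Gamma> x \<in> carrier Tr"
  unfolding gen_gclass by (rule gclass_carrier) (simp add: gwords_def)

lemma gclass_replicate:
  assumes x: "x \<in> verts \<Gamma>"
  shows "gclass [(x, e)] [^]\<^bsub>Tr\<^esub> n = gclass (replicate n (x, e))"
proof (induction n)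
  case 0
  then show ?case by (simp add: nat_pow_def gclass_one)
next
  case (Suc n)
  then have "gclass [(x, e)] [^]\<^bsub>Tr\<^esub> Suc n = gclass (replicate n (x, e)) \<otimes>\<^bsub>Tr\<^esub> gclass [(x, e)]"
    by (simp add: nat_pow_def)
  also have "\<dots> = gclass (replicate n (x, e) @ [(x, e)])"
    using x by (intro gclass_mult) (auto simp: gwords_def)
  finally show ?case by (simp add: replicate_append_same)
qed

lemma gen_pow_gclass:
  assumes x: "x \<in> verts \<Gamma>"
  shows "trickle_gen \<Gamma> x [^]\<^bsub>Tr\<^esub> a = gclass (syl_gword (x, a))"
proof (cases "0 \<le> a")
  case True
  then show ?thesis
    using gclass_replicate[OF x, of True] by (simp add: int_pow_def2 gen_gclass syl_gword_def)
next
  case False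
  interpret group Tr by (rule group_Tr)
  have c: "gclass [(x, e)] \<in> carrier Tr" for e
    using x by (intro gclass_carrier) (simp add: gwords_def)
  have "gclass [(x, False)] \<otimes>\<^bsub>Tr\<^esub> gclass [(x, True)] = \<one>\<^bsub>Tr\<^esub>"
    using gclass_eqI[OF pres_rel.cancel[OF x, of False]] x
    by (subst gclass_mult) (auto simp: gwords_def gclass_one)
  then have "inv\<^bsub>Tr\<^esub> gclass [(x, True)] = gclass [(x, False)]"
    using c by (intro inv_equality)
  from nat_pow_inv[OF c[of True], of "nat (- a)", unfolded this gclass_replicate[OF x]]
  have "inv\<^bsub>Tr\<^esub> gclass (replicate (nat (- a)) (x, True)) = gclass (replicate (nat (- a)) (x, False))"
    by (rule HOL.sym)
  then show ?thesis
    using False unfolding int_pow_def2[of Tr] gen_gclass gclass_replicate[OF x] syl_gword_def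
    by simp
qed

lemma syl_eval_Cons:
  "syl_eval \<Gamma> (s # w) = trickle_gen \<Gamma> (fst s) [^]\<^bsub>Tr\<^esub> snd s \<otimes>\<^bsub>Tr\<^esub> syl_eval \<Gamma> w"
  by (simp add: syl_eval_def split: prod.split)

lemma syl_eval_gclass: "w \<in> syllabic_words \<Gamma> \<Longrightarrow> syl_eval \<Gamma> w = gclass (word_gword w)"
proof (induction w)
  case Nil
  then show ?case by (simp add: syl_eval_def gclass_one)
next
  case (Cons s w)
  then have x: "fst s \<in> verts \<Gamma>" and w: "w \<in> syllabic_words \<Gamma>" using syllabic_Cons[of s w] by auto
  have "syl_eval \<Gamma> (s # w) = gclass (syl_gword s) \<otimes>\<^bsub>Tr\<^esub> gclass (word_gword w)"
    unfolding syl_eval_Cons gen_pow_gclass[OF x] Cons.IH[OF w] by simp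
  then show ?case
    unfolding gclass_mult[OF syl_gword_gwords[OF x] word_gword_gwords[OF w]] by simp
qed

text \<open>An irreducible word is recovered, up to equivalence, by letting its value act on the empty word.\<close>

lemma eqv_of_syl_eval_eq:
  assumes w: "w \<in> irreducible_words" and v: "v \<in> irreducible_words" and e: "syl_eval \<Gamma> w = syl_eval \<Gamma> v"
  shows "w \<approx> v"
proof -
  have s: "w \<in> syllabic_words \<Gamma>" "v \<in> syllabic_words \<Gamma>" using w v by (auto simp: irreducible_words_def)
  have "gclass (word_gword w) = gclass (word_gword v)" using e s syl_eval_gclass by simp
  then have "(word_gword w, word_gword v) \<in> pres_rel (verts \<Gamma>) (trickle_relations \<Gamma>)"
    using word_gword_gwords[OF s(2)] by (rule gclass_eqD)
  from eqv_trans[OF gword_act_pres_rel[OF this irreducible_words_Nil] gword_act_word[OF v]]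
  show ?thesis by (rule eqv_trans[OF eqv_sym[OF gword_act_word[OF w]]])
qed

lemma gen_exchange:
  assumes xy: "adj x y"
  shows "trickle_gen \<Gamma> x [^]\<^bsub>Tr\<^esub> a \<otimes>\<^bsub>Tr\<^esub> trickle_gen \<Gamma> y [^]\<^bsub>Tr\<^esub> b =
    trickle_gen \<Gamma> (twist x a y) [^]\<^bsub>Tr\<^esub> b \<otimes>\<^bsub>Tr\<^esub> trickle_gen \<Gamma> (twist y (- b) x) [^]\<^bsub>Tr\<^esub> a"
proof -
  interpret group Tr by (rule group_Tr)
  have rel: "trickle_gen \<Gamma> x \<otimes>\<^bsub>Tr\<^esub> trickle_gen \<Gamma> y = trickle_gen \<Gamma> (twist x 1 y) \<otimes>\<^bsub>Tr\<^esub> trickle_gen \<Gamma> x"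
    if xy: "adj x y" "\<not> vless \<Gamma> x y" for x y
  proof -
    have v: "x \<in> verts \<Gamma>" "y \<in> verts \<Gamma>" using xy adj_vertsD by auto
    have "vaut \<Gamma> x y = twist x 1 y" "vaut \<Gamma> y x = x"
      using vaut_twist[OF xy(1)] vaut_twist[OF adj_sym[OF xy(1)]] xy(2) by (simp_all add: twist_fixes)
    then have "([(twist x 1 y, True), (x, True)], [(x, True), (y, True)]) \<in> trickle_relations \<Gamma>"
      using xy(1) unfolding trickle_relations_def adj_def by force
    then have "gclass [(twist x 1 y, True), (x, True)] = gclass [(x, True), (y, True)]"
      using v twist_verts[OF v] by (intro gclass_eqI pres_rel.relation) (auto simp: gwords_def)
    then show ?thesis
      using v twist_verts[OF v] by (simp add: gen_gclass gclass_mult gwords_def)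
  qed
  have *: "trickle_gen \<Gamma> x [^]\<^bsub>Tr\<^esub> a \<otimes>\<^bsub>Tr\<^esub> trickle_gen \<Gamma> y [^]\<^bsub>Tr\<^esub> b =
      trickle_gen \<Gamma> (twist x a y) [^]\<^bsub>Tr\<^esub> b \<otimes>\<^bsub>Tr\<^esub> trickle_gen \<Gamma> x [^]\<^bsub>Tr\<^esub> a"
    if xy: "adj x y" "\<not> vless \<Gamma> x y" for x y a and b :: int
  proof (rule exchange_powers[OF group_Tr _ _ _ xy, where h = "\<lambda>x k::int. trickle_gen \<Gamma> x [^]\<^bsub>Tr\<^esub> k"])
    fix x y assume a: "adj x y" "\<not> vless \<Gamma> x y"
    have "x \<in> verts \<Gamma>" "y \<in> verts \<Gamma>" "twist x 1 y \<in> verts \<Gamma>" using a(1) adj_vertsD twist_verts by blast+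
    then show "trickle_gen \<Gamma> x [^]\<^bsub>Tr\<^esub> (1::int) \<otimes>\<^bsub>Tr\<^esub> trickle_gen \<Gamma> y [^]\<^bsub>Tr\<^esub> (1::int) =
        trickle_gen \<Gamma> (twist x 1 y) [^]\<^bsub>Tr\<^esub> (1::int) \<otimes>\<^bsub>Tr\<^esub> trickle_gen \<Gamma> x [^]\<^bsub>Tr\<^esub> (1::int)"
      using rel[OF a] gen_carrier by simp
  qed (simp_all add: gen_carrier int_pow_mult)
  show ?thesis
  proof (cases "vless \<Gamma> x y")
    case True
    have y: "y \<in> verts \<Gamma>" using xy adj_vertsD by blast
    have "adj y (twist y (- b) x)" "\<not> vless \<Gamma> y (twist y (- b) x)"
      using adj_below[OF adj_sym[OF xy] vless_asym[OF True]] by auto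
    from *[OF this, of b a] show ?thesis
      using twist_inverse(2)[OF y] twist_above[OF True] by simp
  next
    case False
    then show ?thesis using *[OF xy] by (simp add: twist_fixes)
  qed
qed

lemma gen_pow_mod_period:
  assumes x: "x \<in> verts \<Gamma>"
  shows "trickle_gen \<Gamma> x [^]\<^bsub>Tr\<^esub> (a mod exp_period x) = trickle_gen \<Gamma> x [^]\<^bsub>Tr\<^esub> a"
proof (cases "vlabel \<Gamma> x")
  case (enat n)
  interpret group Tr by (rule group_Tr)
  have "(replicate n (x, True), []) \<in> trickle_relations \<Gamma>"
    using x enat by (auto simp: trickle_relations_def)
  then have "trickle_gen \<Gamma> x [^]\<^bsub>Tr\<^esub> n = \<one>\<^bsub>Tr\<^esub>"
    unfolding gen_gclass gclass_replicate[OF x] gclass_one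
    using x by (intro gclass_eqI pres_rel.relation) (auto simp: gwords_def)
  then have "ord (trickle_gen \<Gamma> x) dvd n" using gen_carrier[OF x] by (simp add: pow_eq_id)
  then have "int (ord (trickle_gen \<Gamma> x)) dvd a - a mod int n"
    by (meson dvd_minus_mod dvd_trans int_dvd_int_iff)
  then show ?thesis using gen_carrier[OF x] by (simp add: int_pow_eq exp_period_def enat)
qed (simp add: exp_period_def)

lemma syl_eval_carrier: "w \<in> syllabic_words \<Gamma> \<Longrightarrow> syl_eval \<Gamma> w \<in> carrier Tr"
  using syl_eval_gclass gclass_carrier word_gword_gwords by simp

lemma syl_eval_append_cong:
  "syl_eval \<Gamma> w = syl_eval \<Gamma> v \<Longrightarrow> syl_eval \<Gamma> (p @ w) = syl_eval \<Gamma> (p @ v)"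
  by (induction p) (simp_all add: syl_eval_Cons)

lemma swap_syl_eval: "swap w v \<Longrightarrow> w \<in> syllabic_words \<Gamma> \<Longrightarrow> syl_eval \<Gamma> w = syl_eval \<Gamma> v"
proof (induction rule: swap.induct)
  case (here s t q)
  interpret group Tr by (rule group_Tr)
  have q: "syl_eval \<Gamma> q \<in> carrier Tr" using here(2) syllabic_Cons syl_eval_carrier by blast
  have v: "fst s \<in> verts \<Gamma>" "fst t \<in> verts \<Gamma>" "fst (lmove s t) \<in> verts \<Gamma>" "fst (rmove s t) \<in> verts \<Gamma>"
    using sadj_verts here(1) sadj_move[OF here(1)] by auto
  have "trickle_gen \<Gamma> (fst s) [^]\<^bsub>Tr\<^esub> snd s \<otimes>\<^bsub>Tr\<^esub> trickle_gen \<Gamma> (fst t) [^]\<^bsub>Tr\<^esub> snd t =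
      trickle_gen \<Gamma> (fst (lmove s t)) [^]\<^bsub>Tr\<^esub> snd (lmove s t) \<otimes>\<^bsub>Tr\<^esub>
      trickle_gen \<Gamma> (fst (rmove s t)) [^]\<^bsub>Tr\<^esub> snd (rmove s t)"
    using gen_exchange[OF here(1)] by (simp add: lmove_def rmove_def)
  then show ?case
    using q v gen_carrier by (simp add: syl_eval_Cons m_assoc[symmetric])
next
  case (there w v s)
  then show ?case using syllabic_Cons[of s w] by (simp add: syl_eval_Cons)
qed


section \<open>The operations\<close>

lemma op_I_facts:
  assumes "(w, w') \<in> op_I \<Gamma>"
  shows "w \<in> syllabic_words \<Gamma>" "w' \<in> syllabic_words \<Gamma>" "syl_eval \<Gamma> w = syl_eval \<Gamma> w'"
    "\<not> merge_free w"
proof -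
  interpret group Tr by (rule group_Tr)
  have sq: "\<exists>p x a b q. w = p @ (x, a) # (x, b) # q \<and> w \<in> syllabic_words \<Gamma> \<and>
    w' = (if (a + b) mod exp_period x = 0 then p @ q else p @ (x, (a + b) mod exp_period x) # q)"
    using assms
  proof cases
    case (cancel u x a b v)
    then have "a \<in> carrier (exp_group \<Gamma> x)" by (auto simp: syllabic_words_def syllables_def)
    then have "b = (- a) mod exp_period x"
      using cancel(4) exp_period_nonneg[of x] by (simp add: exp_group_period)
    then have "(a + b) mod exp_period x = 0" by (simp add: mod_add_right_eq)
    then show ?thesis
      using cancel(1-3) by (intro exI[of _ u] exI[of _ x] exI[of _ a] exI[of _ b] exI[of _ v]) simp
  next
    case (merge u x a b v)
    then have "(a + b) mod exp_period x \<noteq> 0"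
      and "a \<otimes>\<^bsub>exp_group \<Gamma> x\<^esub> b = (a + b) mod exp_period x"
      using exp_period_nonneg[of x] by (simp_all add: exp_group_period)
    then show ?thesis
      using merge(1-3) by (intro exI[of _ u] exI[of _ x] exI[of _ a] exI[of _ b] exI[of _ v]) simp
  qed
  then obtain p x a b q where w: "w = p @ (x, a) # (x, b) # q" and ws: "w \<in> syllabic_words \<Gamma>"
    and w': "w' = (if (a + b) mod exp_period x = 0 then p @ q else p @ (x, (a + b) mod exp_period x) # q)"
    by blast
  show "w \<in> syllabic_words \<Gamma>" by (rule ws)
  have x: "x \<in> verts \<Gamma>" and q: "q \<in> syllabic_words \<Gamma>"
    using ws unfolding w by (auto simp: syllabic_words_def syllables_iff)
  show "w' \<in> syllabic_words \<Gamma>"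
    using ws unfolding w w' by (auto simp: syllabic_words_def syllables_iff)
  have "w \<approx> p @ (x, a) # (x, b) # q" by (simp add: w)
  then show "\<not> merge_free w" unfolding merge_free_def by force
  have "trickle_gen \<Gamma> x [^]\<^bsub>Tr\<^esub> a \<otimes>\<^bsub>Tr\<^esub> trickle_gen \<Gamma> x [^]\<^bsub>Tr\<^esub> b =
      trickle_gen \<Gamma> x [^]\<^bsub>Tr\<^esub> ((a + b) mod exp_period x)"
    using gen_carrier[OF x] gen_pow_mod_period[OF x] by (simp add: int_pow_mult)
  then have "syl_eval \<Gamma> ((x, a) # (x, b) # q) =
      syl_eval \<Gamma> (if (a + b) mod exp_period x = 0 then q else (x, (a + b) mod exp_period x) # q)"
    using gen_carrier[OF x] syl_eval_carrier[OF q] by (simp add: syl_eval_Cons m_assoc[symmetric])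
  from syl_eval_append_cong[OF this, of p]
  show "syl_eval \<Gamma> w = syl_eval \<Gamma> w'" unfolding w w' by simp
qed

text \<open>Two neighbouring syllables at a common vertex always admit an operation of type I: they cancel if
  their exponents add up to zero, and merge otherwise.\<close>

lemma op_I_of_not_merge_free:
  assumes w: "w \<in> syllabic_words \<Gamma>" and n: "\<not> merge_free w"
  obtains v v' where "w \<approx> v" "(v, v') \<in> op_I \<Gamma>" "length v' < length v"
proof -
  obtain p s t q where v: "w \<approx> p @ s # t # q" and st: "fst s = fst t"
    using n unfolding merge_free_def by blast
  obtain x a b where e: "s = (x, a)" "t = (x, b)" using st by (metis prod.collapse)
  let ?v = "p @ [(x, a), (x, b)] @ q"
  have vs: "?v \<in> syllabic_words \<Gamma>" using eqv_syllabic[OF v w] e by simp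
  have wv: "w \<approx> ?v" using v e by simp
  have pa: "p @ (x, a) # (x, b) # q = ?v" by simp
  show ?thesis
  proof (cases "a \<otimes>\<^bsub>exp_group \<Gamma> x\<^esub> b = \<one>\<^bsub>exp_group \<Gamma> x\<^esub>")
    case True
    interpret X: group "exp_group \<Gamma> x" by (simp add: exp_group_period)
    interpret X: comm_group "exp_group \<Gamma> x" by (simp add: exp_group_period)
    have "a \<in> carrier (exp_group \<Gamma> x)" "b \<in> carrier (exp_group \<Gamma> x)"
      using vs by (auto simp: syllabic_words_def syllables_def)
    then have "b = inv\<^bsub>exp_group \<Gamma> x\<^esub> a"
      using True X.inv_equality X.m_comm by metis
    from op_I.cancel[OF vs this] show ?thesis using that[OF wv] by simp
  next
    case False
    from op_I.merge[OF vs this] show ?thesis using that[OF wv] by simp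
  qed
qed

lemma swap_append: "swap w v \<Longrightarrow> swap (p @ w) (p @ v)"
  by (induction p) (auto intro: swap.there)

lemma op_II_iff: "(w, v) \<in> op_II \<Gamma> \<longleftrightarrow> w \<in> syllabic_words \<Gamma> \<and> swap w v"
proof -
  have tw: "vaut_pow \<Gamma> x a y = twist x a y" if "adj x y" for x y a
    using twist_vaut_pow star_iff adj_vertsD that by blast
  have 1: "(u @ [(x, a), (y, b)] @ q,
      u @ [lmove (x, a) (y, b), rmove (x, a) (y, b)] @ q) \<in> op_II \<Gamma>"
    if "u @ [(x, a), (y, b)] @ q \<in> syllabic_words \<Gamma>" "adj x y" for u x a y b q
    using op_II.intros[OF that(1)] that(2) tw adj_sym[OF that(2)]
    by (simp add: lmove_def rmove_def adj_def)
  show ?thesis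
  proof
    assume "(w, v) \<in> op_II \<Gamma>"
    then show "w \<in> syllabic_words \<Gamma> \<and> swap w v"
    proof cases
      case (1 u x a y b q)
      have xy: "adj x y" using 1(4) by (simp add: adj_def)
      have "swap (u @ (x, a) # (y, b) # q)
          (u @ lmove (x, a) (y, b) # rmove (x, a) (y, b) # q)"
        using xy by (intro swap_append swap.here) simp
      then show ?thesis
        using 1 tw[OF xy] tw[OF adj_sym[OF xy]] by (simp add: lmove_def rmove_def)
    qed
  next
    assume "w \<in> syllabic_words \<Gamma> \<and> swap w v"
    then have s: "w \<in> syllabic_words \<Gamma>" and "swap w v" by auto
    from this(2) have "\<exists>u s t q. w = u @ [s, t] @ q \<and> sadj s t \<and>
        v = u @ [lmove s t, rmove s t] @ q"
    proof (induction rule: swap.induct)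
      case (here s t q)
      then show ?case by (metis append_Cons append_Nil)
    next
      case (there w v r)
      then show ?case by (metis append_Cons)
    qed
    then show "(w, v) \<in> op_II \<Gamma>" using 1 s by (metis prod.collapse)
  qed
qed

lemma op_II_rtrancl:
  assumes "w \<in> syllabic_words \<Gamma>" "w \<approx> v"
  shows "(w, v) \<in> (op_II \<Gamma>)\<^sup>*"
  using assms(2)
proof (induction rule: rtranclp_induct)
  case (step y z)
  have "(y, z) \<in> op_II \<Gamma>" using eqv_syllabic[OF step(1) assms(1)] step(2) op_II_iff by blast
  with step(3) show ?case by (rule rtrancl.rtrancl_into_rtrancl)
qed simp

text \<open>From a word in \<^const>\<open>merge_free\<close> only operations of type II can ever be applied, and they
  preserve the length.\<close>

lemma M_reduced_iff:
  assumes w: "w \<in> syllabic_words \<Gamma>"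
  shows "M_reduced \<Gamma> w \<longleftrightarrow> merge_free w"
proof
  assume M: "M_reduced \<Gamma> w"
  show "merge_free w"
  proof (rule ccontr)
    assume "\<not> merge_free w"
    then obtain v v' where v: "w \<approx> v" "(v, v') \<in> op_I \<Gamma>" "length v' < length v"
      by (rule op_I_of_not_merge_free[OF w])
    have "(w, v) \<in> (op_I \<Gamma> \<union> op_II \<Gamma>)\<^sup>*"
      using op_II_rtrancl[OF w v(1)] rtrancl_mono[OF Un_upper2] by (rule rev_subsetD)
    then have "(w, v') \<in> (op_I \<Gamma> \<union> op_II \<Gamma>)\<^sup>*"
      using v(2) by (blast intro: rtrancl.rtrancl_into_rtrancl)
    moreover have "length v' < length w" using v(3) eqv_length[OF v(1)] by simp
    ultimately show False using M unfolding M_reduced_def by blast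
  qed
next
  assume r: "merge_free w"
  have "w \<approx> v" if "(w, v) \<in> (op_I \<Gamma> \<union> op_II \<Gamma>)\<^sup>*" for v
    using that
  proof (induction rule: rtrancl_induct)
    case (step y z)
    have "(y, z) \<notin> op_I \<Gamma>" using merge_free_eqv[OF step(3) r] op_I_facts(4)[of y z] by blast
    then have "swap y z" using step(2) op_II_iff[of y z] by blast
    with step(3) show ?case by (rule rtranclp.rtrancl_into_rtrancl)
  qed simp
  then show "M_reduced \<Gamma> w"
    unfolding M_reduced_def using eqv_length[of w] by (metis less_irrefl)
qed

lemma M_steps_eval:
  assumes "(w, v) \<in> (op_I \<Gamma> \<union> op_II \<Gamma>)\<^sup>*" "w \<in> syllabic_words \<Gamma>"
  shows "v \<in> syllabic_words \<Gamma> \<and> syl_eval \<Gamma> v = syl_eval \<Gamma> w"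
  using assms(1)
proof (induction rule: rtrancl_induct)
  case (step y z)
  from step(2) show ?case
  proof
    assume "(y, z) \<in> op_I \<Gamma>"
    then show ?thesis using op_I_facts(2,3)[of y z] step(3) by simp
  next
    assume "(y, z) \<in> op_II \<Gamma>"
    then show ?thesis
      using op_II_iff[of y z] swap_syl_eval[of y z] swap_syllabic[of y z] step(3) by simp
  qed
qed (simp add: assms(2))

lemma syl_length_le:
  assumes "w \<in> syllabic_words \<Gamma>"
  shows "syl_length \<Gamma> (syl_eval \<Gamma> w) \<le> length w"
  unfolding syl_length_def using assms by (intro Least_le) blast

lemma syl_length_attained:
  assumes "w \<in> syllabic_words \<Gamma>"
  obtains v where "v \<in> syllabic_words \<Gamma>" "syl_eval \<Gamma> v = syl_eval \<Gamma> w" "syl_reduced \<Gamma> v"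
proof -
  have "\<exists>n. \<exists>v \<in> syllabic_words \<Gamma>. syl_eval \<Gamma> v = syl_eval \<Gamma> w \<and> length v = n" using assms by blast
  from LeastI_ex[OF this] obtain v where v: "v \<in> syllabic_words \<Gamma>" "syl_eval \<Gamma> v = syl_eval \<Gamma> w"
    and "length v = syl_length \<Gamma> (syl_eval \<Gamma> w)"
    unfolding syl_length_def by blast
  then have "syl_reduced \<Gamma> v" by (simp add: syl_reduced_def)
  with v show ?thesis by (rule that)
qed

lemma syl_reduced_imp_merge_free:
  assumes w: "w \<in> syllabic_words \<Gamma>" and r: "syl_reduced \<Gamma> w"
  shows "merge_free w"
proof -
  have "\<not> length v < length w" if "(w, v) \<in> (op_I \<Gamma> \<union> op_II \<Gamma>)\<^sup>*" for v
  proof -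
    have "v \<in> syllabic_words \<Gamma>" "syl_eval \<Gamma> v = syl_eval \<Gamma> w" using M_steps_eval[OF that w] by auto
    then show ?thesis using syl_length_le[of v] r unfolding syl_reduced_def by simp
  qed
  then show ?thesis using M_reduced_iff[OF w] unfolding M_reduced_def by blast
qed

text \<open>If \<open>w\<close> is irreducible, compare it with a shortest word for the same element: that word is
  irreducible too, so it is equivalent to \<open>w\<close> and has the same length.\<close>

lemma syl_reduced_iff:
  assumes w: "w \<in> syllabic_words \<Gamma>"
  shows "syl_reduced \<Gamma> w \<longleftrightarrow> M_reduced \<Gamma> w"
proof -
  have "syl_reduced \<Gamma> w" if r: "merge_free w"
  proof -
    obtain v where v: "v \<in> syllabic_words \<Gamma>" "syl_eval \<Gamma> v = syl_eval \<Gamma> w" "syl_reduced \<Gamma> v"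
      using syl_length_attained[OF w] .
    have "v \<in> irreducible_words" "w \<in> irreducible_words" using v(1) w r syl_reduced_imp_merge_free[OF v(1,3)] by (simp_all add: irreducible_words_def)
    from eqv_length[OF eqv_of_syl_eval_eq[OF this v(2)]] show ?thesis
      using v(2,3) unfolding syl_reduced_def by simp
  qed
  then show ?thesis using syl_reduced_imp_merge_free[OF w] M_reduced_iff[OF w] by blast
qed

end

theorem theorem2p8:
  fixes \<Gamma> :: "'v trickle"
  assumes "trickle_graph \<Gamma>"
  shows "(\<forall>w \<in> syllabic_words \<Gamma>. syl_reduced \<Gamma> w \<longleftrightarrow> M_reduced \<Gamma> w) \<and>
    (\<forall>w \<in> syllabic_words \<Gamma>. \<forall>v \<in> syllabic_words \<Gamma>.
      syl_reduced \<Gamma> w \<longrightarrow> syl_reduced \<Gamma> v \<longrightarrow> syl_eval \<Gamma> w = syl_eval \<Gamma> v \<longrightarrow>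
      (w, v) \<in> (op_II \<Gamma>)\<^sup>*)"
proof -
  interpret trickle_graph \<Gamma> by (rule assms)
  show ?thesis
  proof (intro conjI ballI impI)
    fix w v
    assume w: "w \<in> syllabic_words \<Gamma>" and v: "v \<in> syllabic_words \<Gamma>"
      and r: "syl_reduced \<Gamma> w" "syl_reduced \<Gamma> v" and e: "syl_eval \<Gamma> w = syl_eval \<Gamma> v"
    have "w \<in> irreducible_words" "v \<in> irreducible_words"
      using w v syl_reduced_imp_merge_free[OF w r(1)] syl_reduced_imp_merge_free[OF v r(2)] by (simp_all add: irreducible_words_def)
    from eqv_of_syl_eval_eq[OF this e] show "(w, v) \<in> (op_II \<Gamma>)\<^sup>*"
      by (rule op_II_rtrancl[OF w])
  qed (rule syl_reduced_iff)
qed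

end
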